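(* Let $\Omega=(\alpha,\beta)$ with the Lebesgue measure, where $-\infty<\alpha<\beta<\infty$, and let $\varphi$ be an Orlicz function. The Orlicz-Sobolev space $W^{1,\varphi}$ contains a subspace isomorphic to $\ell^\infty$ if and only if $\varphi$ does not satisfy condition $\Delta_2^\infty$.
   Context: An Orlicz function is a convex function $\varphi:[0,\infty)\to[0,\infty)$, not identically $0$, with $\varphi(0)=\lim_{t\to0+}\varphi(t)=0$. The Orlicz space $L^\varphi=L^\varphi(\Omega)$ consists of all (classes of) measurable functions $f:\Omega\to\mathbb C$ with $I_\varphi(\lambda f)=\int_\Omega\varphi(\lambda|f(x)|)\,dx<\infty$ for some $\lambda>0$, with the Luxemburg norm $\|f\|_\varphi=\inf\{\lambda>0: I_\varphi(f/\lambda)\le1\}$. The space $W^{1,\varphi}=W^{1,\varphi}(\Omega)$ consists of all $f\in L^1_{loc}(\Omega)$ whose weak derivative $f'\in L^1_{loc}(\Omega)$ exists and $\|f\|_{1,\varphi}=\|f\|_\varphi+\|f'\|_\varphi<\infty$; it is equipped with the norm $\|\cdot\|_{1,\varphi}$. Condition $\Delta_2^\infty$: there exist $k>0$ and $u_0\ge0$ such that $\varphi(2u)\le k\varphi(u)$ for all $u\ge u_0$. "Isomorphic" means linearly homeomorphic. *)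

theory Defs
  imports "HOL-Analysis.Analysis"
begin

text \<open>
  Complex normed spaces with an explicit carrier. A record is used because the library has no
  complex vector spaces, and because the carrier of the Orlicz--Sobolev space depends on the
  interval and on the Orlicz function, so that it cannot be a type.
\<close>

record 'v cnormed =
  carr :: "'v set"
  add :: "'v \<Rightarrow> 'v \<Rightarrow> 'v"
  smult :: "complex \<Rightarrow> 'v \<Rightarrow> 'v"
  nrm :: "'v \<Rightarrow> real"

text \<open>The locale \<^locale>\<open>Metric_space\<close> demands symmetry and nonnegativity also off the carrier,
  hence the default value \<open>0\<close> there.\<close>

definition norm_dist :: "'v cnormed \<Rightarrow> 'v \<Rightarrow> 'v \<Rightarrow> real" where
  "norm_dist X u v =
     (if u \<in> carr X \<and> v \<in> carr X then nrm X (add X u (smult X (-1) v)) else 0)"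

definition norm_topology :: "'v cnormed \<Rightarrow> 'v topology" where
  "norm_topology X = Metric_space.mtopology (carr X) (norm_dist X)"

definition linear_subspace :: "'v set \<Rightarrow> 'v cnormed \<Rightarrow> bool" where
  "linear_subspace V X \<longleftrightarrow>
     V \<subseteq> carr X \<and> V \<noteq> {} \<and>
     (\<forall>u\<in>V. \<forall>v\<in>V. add X u v \<in> V) \<and>
     (\<forall>c. \<forall>u\<in>V. smult X c u \<in> V)"

definition linear_map_between :: "'v cnormed \<Rightarrow> 'w cnormed \<Rightarrow> ('v \<Rightarrow> 'w) \<Rightarrow> bool" where
  "linear_map_between X Y T \<longleftrightarrow>
     T ` carr X \<subseteq> carr Y \<and>
     (\<forall>u\<in>carr X. \<forall>v\<in>carr X. T (add X u v) = add Y (T u) (T v)) \<and>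
     (\<forall>c. \<forall>u\<in>carr X. T (smult X c u) = smult Y c (T u))"

definition isomorphic_spaces :: "'v cnormed \<Rightarrow> 'w cnormed \<Rightarrow> bool" where
  "isomorphic_spaces X Y \<longleftrightarrow>
     (\<exists>T. linear_map_between X Y T \<and>
          homeomorphic_map (norm_topology X) (norm_topology Y) T)"

definition contains_subspace_isomorphic_to :: "'v cnormed \<Rightarrow> 'w cnormed \<Rightarrow> bool" where
  "contains_subspace_isomorphic_to X Y \<longleftrightarrow>
     (\<exists>V. linear_subspace V X \<and> isomorphic_spaces (X\<lparr>carr := V\<rparr>) Y)"

definition ell_infty :: "(nat \<Rightarrow> complex) cnormed" where
  "ell_infty =
     \<lparr>carr = {x. bounded (range x)},
      add = (\<lambda>x y n. x n + y n),
      smult = (\<lambda>c x n. c * x n),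
      nrm = (\<lambda>x. SUP n. cmod (x n))\<rparr>"

text \<open>The values of \<open>\<phi>\<close> on the negative half-line are irrelevant throughout.\<close>

definition orlicz_function :: "(real \<Rightarrow> real) \<Rightarrow> bool" where
  "orlicz_function \<phi> \<longleftrightarrow>
     convex_on {0..} \<phi> \<and> (\<forall>t\<ge>0. \<phi> t \<ge> 0) \<and> (\<exists>t\<ge>0. \<phi> t \<noteq> 0) \<and>
     \<phi> 0 = 0 \<and> (\<phi> \<longlongrightarrow> 0) (at_right 0)"

definition Delta2_infty :: "(real \<Rightarrow> real) \<Rightarrow> bool" where
  "Delta2_infty \<phi> \<longleftrightarrow> (\<exists>k>0. \<exists>u0\<ge>0. \<forall>u\<ge>u0. \<phi> (2 * u) \<le> k * \<phi> u)"

definition orlicz_modular :: "real set \<Rightarrow> (real \<Rightarrow> real) \<Rightarrow> (real \<Rightarrow> complex) \<Rightarrow> ennreal" where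
  "orlicz_modular \<Omega> \<phi> f = (\<integral>\<^sup>+x. ennreal (\<phi> (cmod (f x))) \<partial>lebesgue_on \<Omega>)"

text \<open>
  Extended-valued: the infimum of the empty set is \<open>\<infinity>\<close>, so that a measurable function
  belongs to the Orlicz space iff its Luxemburg norm is finite.
\<close>

definition luxemburg_norm :: "real set \<Rightarrow> (real \<Rightarrow> real) \<Rightarrow> (real \<Rightarrow> complex) \<Rightarrow> ennreal" where
  "luxemburg_norm \<Omega> \<phi> f =
     (INF l \<in> {l. 0 < l \<and> orlicz_modular \<Omega> \<phi> (\<lambda>x. f x / of_real l) \<le> 1}. ennreal l)"

definition locally_integrable :: "real set \<Rightarrow> (real \<Rightarrow> complex) \<Rightarrow> bool" where
  "locally_integrable \<Omega> f \<longleftrightarrow>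
     (\<forall>K. compact K \<and> K \<subseteq> \<Omega> \<longrightarrow> f absolutely_integrable_on K)"

definition test_function :: "real set \<Rightarrow> (real \<Rightarrow> real) \<Rightarrow> bool" where
  "test_function \<Omega> \<psi> \<longleftrightarrow>
     (\<forall>n x. (deriv ^^ n) \<psi> field_differentiable (at x)) \<and>
     compact (closure {x. \<psi> x \<noteq> 0}) \<and> closure {x. \<psi> x \<noteq> 0} \<subseteq> \<Omega>"

definition is_weak_deriv :: "real set \<Rightarrow> (real \<Rightarrow> complex) \<Rightarrow> (real \<Rightarrow> complex) \<Rightarrow> bool" where
  "is_weak_deriv \<Omega> f g \<longleftrightarrow>
     locally_integrable \<Omega> f \<and> locally_integrable \<Omega> g \<and>
     (\<forall>\<psi>. test_function \<Omega> \<psi> \<longrightarrow>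
        (LINT x|lebesgue_on \<Omega>. deriv \<psi> x *\<^sub>R f x) = - (LINT x|lebesgue_on \<Omega>. \<psi> x *\<^sub>R g x))"

text \<open>A representative; weak derivatives are unique only up to null sets.\<close>

definition weak_deriv :: "real set \<Rightarrow> (real \<Rightarrow> complex) \<Rightarrow> real \<Rightarrow> complex" where
  "weak_deriv \<Omega> f = (SOME g. is_weak_deriv \<Omega> f g)"

definition sobolev_norm :: "real set \<Rightarrow> (real \<Rightarrow> real) \<Rightarrow> (real \<Rightarrow> complex) \<Rightarrow> ennreal" where
  "sobolev_norm \<Omega> \<phi> f = luxemburg_norm \<Omega> \<phi> f + luxemburg_norm \<Omega> \<phi> (weak_deriv \<Omega> f)"

definition sobolev_functions :: "real set \<Rightarrow> (real \<Rightarrow> real) \<Rightarrow> (real \<Rightarrow> complex) set" where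
  "sobolev_functions \<Omega> \<phi> =
     {f. locally_integrable \<Omega> f \<and> (\<exists>g. is_weak_deriv \<Omega> f g) \<and> sobolev_norm \<Omega> \<phi> f < \<infinity>}"

definition ae_eq :: "real set \<Rightarrow> (real \<Rightarrow> real) \<Rightarrow> ((real \<Rightarrow> complex) \<times> (real \<Rightarrow> complex)) set" where
  "ae_eq \<Omega> \<phi> =
     {(f, g). f \<in> sobolev_functions \<Omega> \<phi> \<and> g \<in> sobolev_functions \<Omega> \<phi> \<and>
              (AE x in lebesgue_on \<Omega>. f x = g x)}"

text \<open>
  The space of classes modulo equality almost everywhere on \<open>\<Omega>\<close>. Operations and norm are induced
  from representatives; \<open>the_elem\<close> extracts the common norm of all representatives of a class.
\<close>

definition orlicz_sobolev :: "real set \<Rightarrow> (real \<Rightarrow> real) \<Rightarrow> (real \<Rightarrow> complex) set cnormed" where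
  "orlicz_sobolev \<Omega> \<phi> =
     \<lparr>carr = sobolev_functions \<Omega> \<phi> // ae_eq \<Omega> \<phi>,
      add = (\<lambda>A B. \<Union>f\<in>A. \<Union>g\<in>B. ae_eq \<Omega> \<phi> `` {\<lambda>x. f x + g x}),
      smult = (\<lambda>c A. \<Union>f\<in>A. ae_eq \<Omega> \<phi> `` {\<lambda>x. c * f x}),
      nrm = (\<lambda>A. enn2real (the_elem (sobolev_norm \<Omega> \<phi> ` A)))\<rparr>"

end

theory Submission
  imports Defs "HOL-Computational_Algebra.Polynomial"
begin

text \<open>
  The two directions rest on one dichotomy: without \<open>\<Delta>\<^sub>2\<close> the space \<open>L\<^sup>\<phi>\<close> contains \<open>\<ell>\<^sup>\<infinity>\<close>, and with \<open>\<Delta>\<^sub>2\<close> it is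
  separable. Both facts pass to the Orlicz--Sobolev space, the first by integration and the second because a
  function and its derivative embed it into two copies of \<open>L\<^sup>\<phi>\<close>.

  Suppose that \<open>\<Delta>\<^sub>2\<close> fails. Then there are \<open>u\<^sub>n\<close> for which \<open>\<phi>(2 u\<^sub>n)\<close> exceeds \<open>\<phi>(u\<^sub>n)\<close> by a factor growing
  geometrically. The function with value \<open>u\<^sub>n\<close> on pairwise disjoint sets of measure \<open>2 / \<phi>(2 u\<^sub>n)\<close> has modular at most
  \<open>1\<close>, but each of its pieces has norm at least \<open>1/2\<close>. Multiplying the pieces by the terms of a bounded sequence
  therefore changes the supremum norm at most by the factor \<open>2\<close> (\<open>ell_infty_copy_in_L_phi\<close>). Since \<open>L\<^sup>\<phi>\<close> is contained
  in \<open>L\<^sup>1\<close> on a bounded interval, taking primitives maps \<open>L\<^sup>\<phi>\<close> boundedly into \<open>W\<^sup>1\<^sup>,\<^sup>\<phi>\<close>, with the derivative as a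
  left inverse, and carries this copy of \<open>\<ell>\<^sup>\<infinity>\<close> along (\<open>contains_ell_infty\<close>).

  Suppose that \<open>\<Delta>\<^sub>2\<close> holds. On a bounded interval every function in \<open>L\<^sup>\<phi>\<close> then has finite modular at every scale
  (\<open>modular_scale_finite\<close>), so dominated convergence holds in the Luxemburg norm and step functions with values in a
  countable set are dense (\<open>Delta2_separable\<close>). The space \<open>\<ell>\<^sup>\<infinity>\<close> contains uncountably many points at mutual distance
  \<open>1\<close>. A homeomorphic copy of it cannot live in a separable metric space (\<open>Delta2_no_ell_infty\<close>).

  The norm of the space involves an arbitrarily selected weak derivative. That it is well defined on classes and
  satisfies the triangle inequality depends on the uniqueness of weak derivatives, which requires a supply
  of smooth functions with compact support (\<open>AE_zero_if_test_integrals_zero\<close>).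
\<close>

section \<open>Smooth bump functions\<close>

text \<open>
  The functions \<open>P (1/q)\<^sup>m exp(-1/q)\<close>, cut off to \<open>0\<close> where the polynomial \<open>q\<close> is not positive.
  With \<open>P = 1\<close> and \<open>m = 0\<close> this is the classical flat function composed with \<open>q\<close>; the factors
  \<open>P\<close> and \<open>(1/q)\<^sup>m\<close> make the family closed under differentiation, so that smoothness follows from
  a single computation.
\<close>

definition flat_bump :: "real poly \<Rightarrow> real poly \<Rightarrow> nat \<Rightarrow> real \<Rightarrow> real" where
  "flat_bump q P m x =
     (if poly q x > 0 then poly P x * (1 / poly q x) ^ m * exp (- (1 / poly q x)) else 0)"

lemma power_times_exp_minus_le:
  fixes t :: real assumes "t \<ge> 0" shows "t ^ n * exp (- t) \<le> fact n"
proof -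
  have "(\<Sum>k\<in>{n}. t ^ k /\<^sub>R fact k) \<le> (\<Sum>k. t ^ k /\<^sub>R fact k)"
    by (rule sum_le_suminf[OF summable_exp_generic]) (use assms in auto)
  then have "t ^ n / fact n \<le> exp t" by (simp add: exp_def divide_inverse mult.commute)
  then show ?thesis by (simp add: exp_minus field_simps)
qed

text \<open>
  Where \<open>q > 0\<close> this is the quotient and chain rule, where \<open>q < 0\<close> the function vanishes locally.
  At a zero of \<open>q\<close> the exponential beats every power of \<open>1/q\<close>: two powers of \<open>q\<close> can be split off,
  and \<open>q\<^sup>2\<close> vanishes to second order there, so the difference quotient tends to \<open>0\<close>.
\<close>

lemma flat_bump_deriv:
  "(flat_bump q P m has_field_derivative
     flat_bump q (pderiv P * q^2 - of_nat m * P * pderiv q * q + P * pderiv q) (m + 2) x) (at x)"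
proof -
  consider "poly q x > 0" | "poly q x < 0" | "poly q x = 0" by linarith
  then show ?thesis
  proof cases
    case 1
    let ?f = "\<lambda>x. poly P x * (1 / poly q x) ^ m * exp (- (1 / poly q x))"
    let ?R = "pderiv P * q^2 - of_nat m * P * pderiv q * q + P * pderiv q"
    define y where "y = poly q x"
    define e where "e = exp (- (1 / y))"
    define i where "i = 1 / y"
    have y: "y > 0" using 1 by (simp add: y_def)
    let ?A = "poly (pderiv P) x" and ?P = "poly P x" and ?Q = "poly (pderiv q) x"
    have "(?f has_field_derivative
       ?A * i ^ m * e + ?P * (real m * i ^ (m - 1) * (- ?Q * i^2)) * e
        + ?P * i ^ m * (e * (?Q * i^2))) (at x)"
      using y unfolding i_def e_def
      by (auto intro!: derivative_eq_intros simp: y_def[symmetric] power2_eq_square algebra_simps divide_inverse)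
    moreover have "?A * i ^ m * e + ?P * (real m * i ^ (m - 1) * (- ?Q * i^2)) * e
        + ?P * i ^ m * (e * (?Q * i^2)) = poly ?R x * i ^ (m+2) * e"
    proof -
      have 1: "real m * i ^ (m - 1) = real m * i ^ m * y"
        using y by (cases m) (auto simp: i_def)
      have 2: "?A * i ^ m * e = ?A * (i ^ 2 * y ^ 2) * i ^ m * e"
        using y by (simp add: i_def power2_eq_square)
      have 3: "poly ?R x = ?A * y ^ 2 - real m * ?P * ?Q * y + ?P * ?Q"
        by (simp add: y_def of_nat_poly)
      show ?thesis
        unfolding 1 2 3 power_add by (simp add: algebra_simps del: power_divide)
    qed
    ultimately have "(?f has_field_derivative poly ?R x * i ^ (m+2) * e) (at x)"
      by (rule DERIV_cong)
    then have "(?f has_field_derivative flat_bump q ?R (m+2) x) (at x)"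
      using 1 by (simp add: flat_bump_def i_def e_def y_def)
    then show ?thesis
      by (rule has_field_derivative_transform_within_open[where S="{y. poly q y > 0}"])
         (use 1 in \<open>auto intro!: open_Collect_less continuous_intros simp: flat_bump_def\<close>)
  next
    case 2
    have "((\<lambda>_. 0) has_field_derivative 0) (at x)" by simp
    then have "(flat_bump q P m has_field_derivative 0) (at x)"
      by (rule has_field_derivative_transform_within_open[where S="{y. poly q y < 0}"])
         (use 2 in \<open>auto intro!: open_Collect_less continuous_intros simp: flat_bump_def\<close>)
    then show ?thesis using 2 by (simp add: flat_bump_def)
  next
    case 3
    then obtain s where s: "q = [:-x, 1:] * s"
      by (auto simp: poly_eq_0_iff_dvd elim: dvdE)
    let ?b = "\<lambda>y. \<bar>poly P y\<bar> * fact (m+2) * (poly s y)^2 * \<bar>y - x\<bar>"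
    have bound: "norm ((flat_bump q P m y - flat_bump q P m x) / (y - x)) \<le> ?b y" if "y \<noteq> x" for y
    proof (cases "poly q y > 0")
      case True
      have q: "(poly q y)^2 = (\<bar>y - x\<bar> * poly s y)^2"
      proof -
        have "poly q y = (y - x) * poly s y" by (simp add: s algebra_simps)
        then show ?thesis by (simp add: power_mult_distrib)
      qed
      let ?Q = "poly q y"
      \<comment> \<open>Two powers of q are split off and the remaining ones are absorbed by the exponential.\<close>
      have "norm (flat_bump q P m y) = \<bar>poly P y\<bar> * ?Q^2 * ((1 / ?Q) ^ (m+2) * exp (- (1 / ?Q)))"
        using True by (simp add: flat_bump_def abs_mult power_add power2_eq_square field_simps)
      also have "\<dots> \<le> \<bar>poly P y\<bar> * ?Q^2 * fact (m+2)"
        using True by (intro mult_left_mono power_times_exp_minus_le) auto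
      also have "\<dots> = ?b y * \<bar>y - x\<bar>"
        unfolding q by (simp only: power_mult_distrib power2_eq_square mult_ac)
      finally show ?thesis
        using that 3 by (simp add: flat_bump_def field_simps)
    qed (use 3 in \<open>simp add: flat_bump_def\<close>)
    have "(?b \<longlongrightarrow> ?b x) (at x)"
      by (intro tendsto_intros)
    then have "(?b \<longlongrightarrow> 0) (at x)" by simp
    then have "((\<lambda>y. (flat_bump q P m y - flat_bump q P m x) / (y - x)) \<longlongrightarrow> 0) (at x)"
      by (rule Lim_null_comparison[rotated]) (use bound in \<open>auto simp: eventually_at_filter\<close>)
    then show ?thesis using 3 by (simp add: has_field_derivative_iff flat_bump_def)
  qed
qed

lemma higher_deriv_flat_bump: "\<exists>P' m'. (deriv ^^ n) (flat_bump q P m) = flat_bump q P' m'"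
proof (induction n)
  case (Suc n)
  then obtain P' m' where "(deriv ^^ n) (flat_bump q P m) = flat_bump q P' m'" by blast
  moreover have "deriv (flat_bump q P' m') =
      flat_bump q (pderiv P' * q^2 - of_nat m' * P' * pderiv q * q + P' * pderiv q) (m' + 2)"
    by (rule ext) (rule DERIV_imp_deriv[OF flat_bump_deriv])
  ultimately show ?case by auto
qed auto

lemma higher_deriv_flat_bump_differentiable:
  "(deriv ^^ n) (flat_bump q P m) field_differentiable (at x)"
  using higher_deriv_flat_bump[of n q P m] flat_bump_deriv
  by (metis field_differentiable_def)

text \<open>
  As \<open>n\<close> grows, these bumps with support \<open>[a, b]\<close> increase to the indicator function of
  \<open>(a, b)\<close>; this is how test functions see the integral of a function over an interval.
\<close>

definition interval_bump :: "real \<Rightarrow> real \<Rightarrow> nat \<Rightarrow> real \<Rightarrow> real" where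
  "interval_bump a b n = flat_bump (of_nat (Suc n) * ([:-a, 1:] * [:b, -1:])) 1 0"

lemma interval_bump_eq:
  assumes "a < b"
  shows "interval_bump a b n x =
     (if a < x \<and> x < b then exp (- (1 / (real (Suc n) * ((x - a) * (b - x))))) else 0)"
proof -
  have "poly (of_nat (Suc n) * ([:-a, 1:] * [:b, -1:])) x = real (Suc n) * ((x - a) * (b - x))"
    by (simp only: poly_mult of_nat_poly) (simp add: algebra_simps)
  moreover have "real (Suc n) * ((x - a) * (b - x)) > 0 \<longleftrightarrow> a < x \<and> x < b"
    using assms by (subst zero_less_mult_iff) (auto simp: zero_less_mult_iff)
  ultimately show ?thesis
    by (simp only: interval_bump_def flat_bump_def) simp
qed

lemma test_function_interval_bump:
  assumes "a < b" "{a..b} \<subseteq> \<Omega>"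
  shows "test_function \<Omega> (interval_bump a b n)"
proof -
  have "closure {x. interval_bump a b n x \<noteq> 0} \<subseteq> {a..b}"
    by (rule closure_minimal) (auto simp: interval_bump_eq[OF assms(1)] split: if_splits)
  moreover have "(deriv ^^ k) (interval_bump a b n) field_differentiable (at x)" for k x
    unfolding interval_bump_def by (rule higher_deriv_flat_bump_differentiable)
  ultimately show ?thesis
    using assms compact_Int_closed[OF compact_Icc[of a b], of "closure {x. interval_bump a b n x \<noteq> 0}"]
    by (auto simp: test_function_def Int_absorb1)
qed

lemma interval_bump_tendsto:
  assumes "a < b"
  shows "(\<lambda>n. interval_bump a b n x) \<longlonglongrightarrow> indicator {a<..<b} x"
proof (cases "a < x \<and> x < b")
  case True
  let ?c = "1 / ((x - a) * (b - x))"
  have "(\<lambda>n. exp (- (?c * inverse (real (Suc n))))) \<longlonglongrightarrow> exp (- (?c * 0))"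
    by (intro tendsto_intros LIMSEQ_inverse_real_of_nat)
  then show ?thesis using True
    by (simp add: interval_bump_eq[OF assms] divide_inverse mult.commute)
next
  case False
  then show ?thesis by (simp only: interval_bump_eq[OF assms] if_False) auto
qed

lemma interval_bump_bounds:
  assumes "a < b" shows "0 \<le> interval_bump a b n x" "interval_bump a b n x \<le> indicator {a<..<b} x"
  by (auto simp: interval_bump_eq[OF assms])

lemma interval_bump_measurable [measurable]: "interval_bump a b n \<in> borel_measurable borel"
  unfolding interval_bump_def
  by (intro borel_measurable_continuous_onI continuous_at_imp_continuous_on ballI DERIV_isCont[OF flat_bump_deriv])

section \<open>The fundamental lemma of the calculus of variations\<close>

text \<open>
  Open intervals form an intersection-stable generator of the Borel sets, so by Dynkin's lemma all
  Borel sets have integral zero; a Lebesgue set differs from a Borel set by a null set.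
\<close>

lemma AE_zero_if_interval_integrals_zero:
  fixes h :: "real \<Rightarrow> complex"
  assumes h: "integrable (lebesgue_on {a<..<b}) h"
    and zero: "\<And>c d. (LINT x:{c<..<d}|lebesgue_on {a<..<b}. h x) = 0"
  shows "AE x in lebesgue_on {a<..<b}. h x = 0"
proof -
  let ?M = "lebesgue_on {a<..<b}"
  interpret finite_measure ?M
    by (rule finite_measure_lebesgue_on) simp
  have borel_in: "A \<inter> {a<..<b} \<in> sets ?M" if "A \<in> sets borel" for A :: "real set"
    using that by (auto simp: sets_restrict_space)
  have set_int: "set_integrable ?M A h" if "A \<in> sets borel" for A
  proof -
    have "integrable ?M (\<lambda>x. indicat_real (A \<inter> {a<..<b}) x *\<^sub>R h x)"
      by (rule integrable_mult_indicator[OF borel_in[OF that] h])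
    then show ?thesis
      unfolding set_integrable_def by (subst Bochner_Integration.integrable_cong[OF refl]) (auto simp: indicator_def)
  qed
  have whole: "integral\<^sup>L ?M h = 0"
  proof -
    have "integral\<^sup>L ?M h = (LINT x:{a<..<b}|?M. h x)"
      unfolding set_lebesgue_integral_def by (rule Bochner_Integration.integral_cong) auto
    then show ?thesis by (simp add: zero)
  qed
  have bq: "sets borel = sigma_sets UNIV (range (\<lambda>(c, d). {c<..<d::real}))"
    by (simp add: borel_eq_box[where 'a=real] box_real)
  have borel: "(LINT x:A|?M. h x) = 0" if "A \<in> sets borel" for A :: "real set"
  proof -
    have A: "A \<in> sigma_sets UNIV (range (\<lambda>(c, d). {c<..<d::real}))"
      using that by (simp add: bq)
    show ?thesis
    proof (rule sigma_sets_induct_disjoint[OF _ _ A])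
      show "Int_stable (range (\<lambda>(c, d). {c<..<d::real}))"
      proof (rule Int_stableI)
        fix A B assume "A \<in> range (\<lambda>(c, d). {c<..<d::real})" "B \<in> range (\<lambda>(c, d). {c<..<d::real})"
        then obtain c d c' d' where "A = {c<..<d}" "B = {c'<..<d'}" by auto
        then have "A \<inter> B = {max c c'<..<min d d'}" by auto
        then show "A \<inter> B \<in> range (\<lambda>(c, d). {c<..<d::real})" by (intro image_eqI[where x="(max c c', min d d')"]) auto
      qed
    next
      fix A :: "real set" assume "A \<in> sigma_sets UNIV (range (\<lambda>(c, d). {c<..<d}))"
        and A0: "(LINT x:A|?M. h x) = 0"
      then have A: "A \<in> sets borel" by (simp add: bq)
      have "(LINT x:UNIV - A|?M. h x) = integral\<^sup>L ?M (\<lambda>x. h x - indicat_real A x *\<^sub>R h x)"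
        unfolding set_lebesgue_integral_def
        by (rule Bochner_Integration.integral_cong) (auto simp: indicator_def)
      also have "\<dots> = 0"
        using set_int[OF A] A0 whole h
        by (simp add: set_integrable_def set_lebesgue_integral_def)
      finally show "(LINT x:UNIV - A|?M. h x) = 0" .
    next
      fix A :: "nat \<Rightarrow> real set"
      assume dis: "disjoint_family A" and A: "range A \<subseteq> sigma_sets UNIV (range (\<lambda>(c, d). {c<..<d}))"
        and A0: "\<And>i. (LINT x:A i|?M. h x) = 0"
      have Ai: "A i \<in> sets borel" for i
        using A by (auto simp: bq)
      let ?B = "\<lambda>i. A i \<inter> {a<..<b}"
      have eq: "(LINT x:C|?M. h x) = (LINT x:C \<inter> {a<..<b}|?M. h x)" for C
        unfolding set_lebesgue_integral_def
        by (rule Bochner_Integration.integral_cong) (auto simp: indicator_def)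
      have "(LINT x:(\<Union>i. ?B i)|?M. h x) = (\<Sum>i. LINT x:?B i|?M. h x)"
      proof (rule lebesgue_integral_countable_add)
        show "set_integrable ?M (\<Union>i. ?B i) h"
          unfolding set_integrable_def
          using borel_in[OF Ai] by (intro integrable_mult_indicator[OF _ h] sets.countable_UN) auto
      qed (use borel_in[OF Ai] dis in \<open>auto simp: disjoint_family_on_def\<close>)
      also have "\<dots> = 0" using A0 eq[symmetric] by simp
      finally show "(LINT x:(\<Union>i. A i)|?M. h x) = 0"
        using eq[of "\<Union>i. A i"] by simp
    next
      show "(LINT x:{}|?M. h x) = 0" by (simp add: set_lebesgue_integral_def)
    qed (auto simp: zero)
  qed
  show ?thesis
  proof (rule density_zero[OF h])
    fix A assume "A \<in> sets ?M"
    then have A: "A \<in> sets lebesgue" and sub: "A \<subseteq> {a<..<b}"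
      by (auto simp: sets_restrict_space_iff)
    obtain S N N' where SN: "A = S \<union> N" "N \<subseteq> N'" "N' \<in> null_sets lborel" "S \<in> sets lborel"
      using sets_completionE[OF A] .
    have "AE x in lebesgue. x \<notin> N'"
      by (rule AE_not_in) (rule null_sets_completionI[OF SN(3)])
    then have "AE x in ?M. x \<notin> N'"
      by (subst AE_restrict_space_iff) (auto elim: eventually_mono)
    then have "AE x in ?M. indicat_real A x *\<^sub>R h x = indicat_real S x *\<^sub>R h x"
    proof eventually_elim
      case (elim x)
      then have "x \<in> A \<longleftrightarrow> x \<in> S" using SN by blast
      then show ?case by (simp add: indicator_def)
    qed
    then have "(LINT x:A|?M. h x) = (LINT x:S|?M. h x)"
      unfolding set_lebesgue_integral_def
    proof (intro integral_cong_AE)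
      show "(\<lambda>x. indicat_real A x *\<^sub>R h x) \<in> borel_measurable ?M"
        using integrable_mult_indicator[OF \<open>A \<in> sets ?M\<close> h] by auto
      show "(\<lambda>x. indicat_real S x *\<^sub>R h x) \<in> borel_measurable ?M"
        using set_int[of S] SN(4) by (auto simp: set_integrable_def)
    qed
    then show "(LINT x:A|?M. h x) = 0"
      using borel[of S] SN(4) by simp
  qed
qed

lemma locally_integrableD:
  assumes "locally_integrable \<Omega> g" "{a..b} \<subseteq> \<Omega>"
  shows "integrable (lebesgue_on {a..b::real}) g"
proof -
  have "g absolutely_integrable_on {a..b}"
    using assms by (auto simp: locally_integrable_def)
  then show ?thesis
    by (simp add: set_integrable_def integrable_restrict_space)
qed

text \<open>
  Local integrability gives measurability on each compact subinterval, and countably many of them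
  exhaust the open interval.
\<close>

lemma locally_integrable_measurable:
  assumes "locally_integrable {\<alpha><..<\<beta>} g"
  shows "g \<in> borel_measurable (lebesgue_on {\<alpha><..<\<beta>::real})"
proof (rule measurable_piecewise_restrict[where C = "range (\<lambda>n::nat. {\<alpha> + 1 / Suc n..\<beta> - 1 / Suc n})"])
  show "space (lebesgue_on {\<alpha><..<\<beta>}) \<subseteq> \<Union> (range (\<lambda>n::nat. {\<alpha> + 1 / Suc n..\<beta> - 1 / Suc n}))"
  proof
    fix x assume "x \<in> space (lebesgue_on {\<alpha><..<\<beta>})"
    then have "min (x - \<alpha>) (\<beta> - x) > 0" by auto
    then obtain n where "1 / real (Suc n) < min (x - \<alpha>) (\<beta> - x)"
      using nat_approx_posE by blast
    then show "x \<in> \<Union> (range (\<lambda>n::nat. {\<alpha> + 1 / Suc n..\<beta> - 1 / Suc n}))"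
      by (intro UN_I[of n]) auto
  qed
next
  fix K assume "K \<in> range (\<lambda>n::nat. {\<alpha> + 1 / Suc n..\<beta> - 1 / Suc n})"
  then obtain n :: nat where K: "K = {\<alpha> + 1 / Suc n..\<beta> - 1 / Suc n}" by auto
  have sub: "K \<subseteq> {\<alpha><..<\<beta>}"
  proof
    fix x assume "x \<in> K"
    moreover have "1 / real (Suc n) > 0" by simp
    ultimately show "x \<in> {\<alpha><..<\<beta>}"
      unfolding K atLeastAtMost_iff greaterThanLessThan_iff by linarith
  qed
  then have "integrable (lebesgue_on K) g"
    using locally_integrableD[OF assms] unfolding K by blast
  then have "g \<in> borel_measurable (lebesgue_on K)" by auto
  then show "g \<in> borel_measurable (restrict_space (lebesgue_on {\<alpha><..<\<beta>}) K)"
    using sub by (subst restrict_restrict_space) (auto simp: K Int_absorb1)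
  show "K \<inter> space (lebesgue_on {\<alpha><..<\<beta>}) \<in> sets (lebesgue_on {\<alpha><..<\<beta>})"
    by (auto simp: K sets_restrict_space)
qed auto

lemma locally_integrable_indicator:
  assumes "locally_integrable \<Omega> g" "{a..b::real} \<subseteq> \<Omega>" "\<Omega> \<in> sets lebesgue"
    and A: "A \<in> sets lebesgue" "A \<subseteq> {a..b}"
  shows "integrable (lebesgue_on \<Omega>) (\<lambda>x. indicat_real A x *\<^sub>R g x)"
proof -
  have "set_integrable lebesgue {a..b} g"
    using assms by (auto simp: locally_integrable_def)
  then have "set_integrable lebesgue A g"
    by (rule set_integrable_subset) (use A in auto)
  moreover have "(\<lambda>x. indicat_real \<Omega> x *\<^sub>R indicat_real A x *\<^sub>R g x) = (\<lambda>x. indicat_real A x *\<^sub>R g x)"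
    using assms by (auto simp: indicator_def fun_eq_iff)
  ultimately show ?thesis
    using assms by (simp add: integrable_restrict_space set_integrable_def)
qed

text \<open>
  The fundamental lemma of the calculus of variations. Testing against the bumps and passing to the limit
  by dominated convergence yields integral zero over every compactly contained interval.
\<close>

lemma AE_zero_if_test_integrals_zero:
  fixes g :: "real \<Rightarrow> complex"
  assumes g: "locally_integrable {\<alpha><..<\<beta>} g"
    and zero: "\<And>\<psi>. test_function {\<alpha><..<\<beta>} \<psi> \<Longrightarrow>
                 (LINT x|lebesgue_on {\<alpha><..<\<beta>}. \<psi> x *\<^sub>R g x) = 0"
  shows "AE x in lebesgue_on {\<alpha><..<\<beta>}. g x = 0"
proof -
  let ?\<Omega> = "{\<alpha><..<\<beta>}"
  have meas [measurable]: "g \<in> borel_measurable (lebesgue_on ?\<Omega>)"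
    by (rule locally_integrable_measurable[OF g])
  have interval: "(LINT x|lebesgue_on ?\<Omega>. indicat_real {c<..<d} x *\<^sub>R g x) = 0"
    if "\<alpha> < c" "d < \<beta>" for c d
  proof (cases "c < d")
    case True
    have sub: "{c..d} \<subseteq> ?\<Omega>" using that by auto
    have "(\<lambda>n. LINT x|lebesgue_on ?\<Omega>. interval_bump c d n x *\<^sub>R g x)
        \<longlonglongrightarrow> (LINT x|lebesgue_on ?\<Omega>. indicat_real {c<..<d} x *\<^sub>R g x)"
    proof (rule integral_dominated_convergence)
      show "integrable (lebesgue_on ?\<Omega>) (\<lambda>x. norm (indicat_real {c<..<d} x *\<^sub>R g x))"
        by (intro integrable_norm locally_integrable_indicator[OF g sub]) auto
      show "(\<lambda>x. indicat_real {c<..<d} x *\<^sub>R g x) \<in> borel_measurable (lebesgue_on ?\<Omega>)"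
        by (rule borel_measurable_integrable[OF locally_integrable_indicator[OF g sub]]) auto
      show "AE x in lebesgue_on ?\<Omega>. (\<lambda>n. interval_bump c d n x *\<^sub>R g x) \<longlonglongrightarrow> indicat_real {c<..<d} x *\<^sub>R g x"
        by (intro AE_I2 tendsto_intros interval_bump_tendsto True)
      show "AE x in lebesgue_on ?\<Omega>. norm (interval_bump c d n x *\<^sub>R g x)
              \<le> norm (indicat_real {c<..<d} x *\<^sub>R g x)" for n
        using interval_bump_bounds[OF True] by (auto intro!: mult_right_mono)
      have "interval_bump c d n \<in> borel_measurable (lebesgue_on ?\<Omega>)" for n
        by (intro measurable_restrict_space1 measurable_completion) simp
      then show "(\<lambda>x. interval_bump c d n x *\<^sub>R g x) \<in> borel_measurable (lebesgue_on ?\<Omega>)" for n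
        by (intro borel_measurable_scaleR meas)
    qed
    then show ?thesis
      using zero[OF test_function_interval_bump[OF True sub]] by (simp add: LIMSEQ_const_iff)
  qed simp
  let ?K = "\<lambda>n::nat. {\<alpha> + 1 / Suc n<..<\<beta> - 1 / Suc n}"
  have "AE x in lebesgue_on (?K n). g x = 0" for n
  proof (rule AE_zero_if_interval_integrals_zero)
    have pos: "1 / real (Suc n) > 0" by simp
    have sub: "{\<alpha> + 1 / Suc n..\<beta> - 1 / Suc n} \<subseteq> ?\<Omega>"
    proof
      fix x assume "x \<in> {\<alpha> + 1 / Suc n..\<beta> - 1 / Suc n}"
      then show "x \<in> ?\<Omega>"
        using pos unfolding atLeastAtMost_iff greaterThanLessThan_iff by linarith
    qed
    have "set_integrable lebesgue {\<alpha> + 1 / Suc n..\<beta> - 1 / Suc n} g"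
      using g sub by (auto simp: locally_integrable_def)
    then have "set_integrable lebesgue (?K n) g"
      by (rule set_integrable_subset) auto
    then show "integrable (lebesgue_on (?K n)) g"
      by (simp add: integrable_restrict_space set_integrable_def)
    show "(LINT x:{c<..<d}|lebesgue_on (?K n). g x) = 0" for c d
    proof -
      let ?I = "{max c (\<alpha> + 1 / Suc n)<..<min d (\<beta> - 1 / Suc n)}"
      have "(LINT x:{c<..<d}|lebesgue_on (?K n). g x) = (LINT x|lebesgue. indicat_real ?I x *\<^sub>R g x)"
        unfolding set_lebesgue_integral_def
        by (subst integral_restrict_space)
          (auto simp: indicator_def intro!: Bochner_Integration.integral_cong)
      also have "\<dots> = (LINT x|lebesgue_on ?\<Omega>. indicat_real ?I x *\<^sub>R g x)"
      proof -
        have "?I \<subseteq> ?\<Omega>"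
          using sub by (auto simp: subset_eq)
        then show ?thesis
          by (subst integral_restrict_space)
            (auto simp: indicator_def subset_eq intro!: Bochner_Integration.integral_cong)
      qed
      also have "\<dots> = 0"
        by (rule interval) (use pos in linarith)+
      finally show ?thesis .
    qed
  qed
  then have "AE x in lebesgue. x \<in> ?K n \<longrightarrow> g x = 0" for n
    by (subst (asm) AE_restrict_space_iff) auto
  then have "AE x in lebesgue. \<forall>n. x \<in> ?K n \<longrightarrow> g x = 0"
    unfolding AE_all_countable by blast
  then have "AE x in lebesgue. x \<in> ?\<Omega> \<longrightarrow> g x = 0"
  proof eventually_elim
    case (elim x)
    show ?case
    proof
      assume "x \<in> ?\<Omega>"
      then have "min (x - \<alpha>) (\<beta> - x) > 0" by auto
      then obtain n where "1 / real (Suc n) < min (x - \<alpha>) (\<beta> - x)"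
        using nat_approx_posE by blast
      then have "x \<in> ?K n" by auto
      then show "g x = 0" using elim by blast
    qed
  qed
  then show ?thesis
    by (subst AE_restrict_space_iff) auto
qed

section \<open>Test functions and weak derivatives\<close>

lemma test_function_higher_deriv:
  "test_function \<Omega> \<psi> \<Longrightarrow> (deriv ^^ n) \<psi> field_differentiable (at x)"
  by (simp add: test_function_def)

lemma test_function_has_deriv:
  "test_function \<Omega> \<psi> \<Longrightarrow> (\<psi> has_field_derivative deriv \<psi> x) (at x)"
  using test_function_higher_deriv[of \<Omega> \<psi> 0 x]
  by (simp add: DERIV_deriv_iff_field_differentiable)

lemma test_function_isCont: "test_function \<Omega> \<psi> \<Longrightarrow> isCont \<psi> x"
  by (rule DERIV_isCont[OF test_function_has_deriv])

lemma test_function_zero: "test_function \<Omega> \<psi> \<Longrightarrow> x \<notin> \<Omega> \<Longrightarrow> \<psi> x = 0"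
  using closure_subset[of "{x. \<psi> x \<noteq> 0}"] by (auto simp: test_function_def)

lemma test_function_deriv:
  assumes "test_function \<Omega> \<psi>"
  shows "test_function \<Omega> (deriv \<psi>)"
proof -
  let ?K = "closure {x. \<psi> x \<noteq> 0}"
  have "deriv \<psi> x = 0" if "x \<notin> ?K" for x
  proof -
    have zero: "0 = \<psi> y" if "y \<in> - ?K" for y
      using subsetD[OF closure_subset, of y "{x. \<psi> x \<noteq> 0}"] that by auto
    have "((\<lambda>_. 0) has_field_derivative 0) (at x)" by simp
    then have "(\<psi> has_field_derivative 0) (at x)"
    proof (rule has_field_derivative_transform_within_open)
      show "open (- ?K)" by (simp add: open_Compl)
      show "x \<in> - ?K" using that by simp
      show "\<And>y. y \<in> - ?K \<Longrightarrow> 0 = \<psi> y" by (rule zero)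
    qed
    then show ?thesis by (rule DERIV_imp_deriv)
  qed
  then have sub: "closure {x. deriv \<psi> x \<noteq> 0} \<subseteq> ?K"
    by (intro closure_minimal) auto
  have "compact ?K" "?K \<subseteq> \<Omega>"
    using assms by (simp_all only: test_function_def)
  then have "compact (closure {x. deriv \<psi> x \<noteq> 0})"
    using compact_Int_closed[OF _ closed_closure, of ?K "{x. deriv \<psi> x \<noteq> 0}"]
    by (simp only: Int_absorb1[OF sub])
  moreover have "(deriv ^^ n) (deriv \<psi>) field_differentiable (at x)" for n x
    using test_function_higher_deriv[OF assms, of "Suc n" x] by (simp add: funpow_swap1)
  ultimately show ?thesis
    using order_trans[OF sub \<open>?K \<subseteq> \<Omega>\<close>] unfolding test_function_def by blast
qed

text \<open>
  A test function stays away from the end points, where a locally integrable function may fail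
  to be integrable.
\<close>

lemma test_function_support_interval:
  assumes "test_function {\<alpha><..<\<beta>} \<psi>"
  obtains a b where "{a..b} \<subseteq> {\<alpha><..<\<beta>}" "\<And>x. x \<notin> {a..b} \<Longrightarrow> \<psi> x = 0"
proof -
  define K where "K = closure {x. \<psi> x \<noteq> 0}"
  have K: "compact K" "K \<subseteq> {\<alpha><..<\<beta>}"
    using assms by (auto simp: test_function_def K_def)
  have zero: "\<psi> x = 0" if "x \<notin> K" for x
    using subsetD[OF closure_subset, of x "{x. \<psi> x \<noteq> 0}"] that unfolding K_def by blast
  show thesis
  proof (cases "K = {}")
    case True
    show thesis
    proof (rule that[of 1 0])
      show "\<psi> x = 0" for x using zero[of x] unfolding True by blast
    qed simp
  next
    case False
    obtain a where a: "a \<in> K" "\<And>x. x \<in> K \<Longrightarrow> a \<le> x"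
      using compact_attains_inf[OF K(1) False] by blast
    obtain b where b: "b \<in> K" "\<And>x. x \<in> K \<Longrightarrow> x \<le> b"
      using compact_attains_sup[OF K(1) False] by blast
    show thesis
    proof (rule that[of a b])
      show "{a..b} \<subseteq> {\<alpha><..<\<beta>}" using a(1) b(1) K(2) by (auto simp: subset_eq)
      show "\<psi> x = 0" if "x \<notin> {a..b}" for x using a(2)[of x] b(2)[of x] zero[of x] that by auto
    qed
  qed
qed

lemma test_function_bounded:
  assumes "test_function {\<alpha><..<\<beta>} \<psi>"
  obtains B where "\<And>x. \<bar>\<psi> x\<bar> \<le> B" "B \<ge> 0"
proof -
  have "compact (\<psi> ` {\<alpha>..\<beta>})"
    using test_function_isCont[OF assms]
    by (intro compact_continuous_image continuous_at_imp_continuous_on) auto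
  then obtain B where B: "\<And>y. y \<in> \<psi> ` {\<alpha>..\<beta>} \<Longrightarrow> \<bar>y\<bar> \<le> B"
    using compact_imp_bounded[of "\<psi> ` {\<alpha>..\<beta>}"] unfolding bounded_real by blast
  have "\<bar>\<psi> x\<bar> \<le> max B 0" for x
    using B[of "\<psi> x"] test_function_zero[OF assms, of x] by (cases "x \<in> {\<alpha>..\<beta>}") auto
  then show thesis by (intro that[of "max B 0"]) auto
qed

lemma test_function_measurable:
  assumes "test_function \<Omega>' \<psi>" shows "\<psi> \<in> borel_measurable (lebesgue_on \<Omega>)"
proof -
  have "\<psi> \<in> borel_measurable borel"
    using test_function_isCont[OF assms]
    by (intro borel_measurable_continuous_onI continuous_at_imp_continuous_on) auto
  then show ?thesis
    by (intro measurable_restrict_space1 measurable_completion) simp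
qed

lemma test_function_integrable:
  assumes \<psi>: "test_function {\<alpha><..<\<beta>} \<psi>" and g: "locally_integrable {\<alpha><..<\<beta>} g"
  shows "integrable (lebesgue_on {\<alpha><..<\<beta>}) (\<lambda>x. \<psi> x *\<^sub>R g x)"
proof -
  obtain a b where ab: "{a..b} \<subseteq> {\<alpha><..<\<beta>}" "\<And>x. x \<notin> {a..b} \<Longrightarrow> \<psi> x = 0"
    using test_function_support_interval[OF \<psi>] by blast
  obtain B where B: "\<And>x. \<bar>\<psi> x\<bar> \<le> B" "B \<ge> 0"
    using test_function_bounded[OF \<psi>] by blast
  have int: "integrable (lebesgue_on {\<alpha><..<\<beta>}) (\<lambda>x. B *\<^sub>R (indicat_real {a..b} x *\<^sub>R g x))"
    by (intro integrable_scaleR_right locally_integrable_indicator[OF g ab(1)]) auto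
  show ?thesis
  proof (rule Bochner_Integration.integrable_bound[OF int])
    show "(\<lambda>x. \<psi> x *\<^sub>R g x) \<in> borel_measurable (lebesgue_on {\<alpha><..<\<beta>})"
      by (intro borel_measurable_scaleR test_function_measurable[OF \<psi>] locally_integrable_measurable[OF g])
    show "AE x in lebesgue_on {\<alpha><..<\<beta>}. norm (\<psi> x *\<^sub>R g x) \<le> norm (B *\<^sub>R (indicat_real {a..b} x *\<^sub>R g x))"
      using ab(2) B by (intro AE_I2) (auto simp: indicator_def intro!: mult_right_mono)
  qed
qed

lemma locally_integrable_lincomb:
  assumes "locally_integrable \<Omega> f" "locally_integrable \<Omega> h"
  shows "locally_integrable \<Omega> (\<lambda>x. f x + c * h x)"
  using assms unfolding locally_integrable_def
  by (intro allI impI set_integral_add(1) set_integrable_mult_right) auto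

lemma is_weak_deriv_lincomb:
  assumes "is_weak_deriv {\<alpha><..<\<beta>} f f'" "is_weak_deriv {\<alpha><..<\<beta>} h h'"
  shows "is_weak_deriv {\<alpha><..<\<beta>} (\<lambda>x. f x + c * h x) (\<lambda>x. f' x + c * h' x)"
  unfolding is_weak_deriv_def
proof (intro conjI allI impI)
  show "locally_integrable {\<alpha><..<\<beta>} (\<lambda>x. f x + c * h x)" "locally_integrable {\<alpha><..<\<beta>} (\<lambda>x. f' x + c * h' x)"
    using assms by (auto simp: is_weak_deriv_def intro: locally_integrable_lincomb)
  fix \<psi> assume \<psi>: "test_function {\<alpha><..<\<beta>} \<psi>"
  have lin: "(LINT x|lebesgue_on {\<alpha><..<\<beta>}. \<eta> x *\<^sub>R (u x + c * v x)) =
      (LINT x|lebesgue_on {\<alpha><..<\<beta>}. \<eta> x *\<^sub>R u x) + c * (LINT x|lebesgue_on {\<alpha><..<\<beta>}. \<eta> x *\<^sub>R v x)"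
    if "test_function {\<alpha><..<\<beta>} \<eta>" "locally_integrable {\<alpha><..<\<beta>} u" "locally_integrable {\<alpha><..<\<beta>} v"
    for \<eta> u v
  proof -
    have "(\<lambda>x. \<eta> x *\<^sub>R (u x + c * v x)) = (\<lambda>x. \<eta> x *\<^sub>R u x + c * (\<eta> x *\<^sub>R v x))"
      by (simp add: algebra_simps)
    then show ?thesis
      using test_function_integrable[OF that(1,2)] test_function_integrable[OF that(1,3)]
      by (simp only: Bochner_Integration.integral_add Bochner_Integration.integral_mult_right
          integrable_mult_right)
  qed
  show "(LINT x|lebesgue_on {\<alpha><..<\<beta>}. deriv \<psi> x *\<^sub>R (f x + c * h x)) =
      - (LINT x|lebesgue_on {\<alpha><..<\<beta>}. \<psi> x *\<^sub>R (f' x + c * h' x))"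
    using assms \<psi> test_function_deriv[OF \<psi>]
    by (subst (1 2) lin) (auto simp: is_weak_deriv_def)
qed

text \<open>
  The difference of the two derivatives annihilates every test function, because the difference of
  the two functions vanishes almost everywhere.
\<close>

lemma is_weak_deriv_AE_unique:
  assumes f: "is_weak_deriv {\<alpha><..<\<beta>} f f'" and h: "is_weak_deriv {\<alpha><..<\<beta>} h h'"
    and eq: "AE x in lebesgue_on {\<alpha><..<\<beta>}. f x = h x"
  shows "AE x in lebesgue_on {\<alpha><..<\<beta>}. f' x = h' x"
proof -
  have d: "is_weak_deriv {\<alpha><..<\<beta>} (\<lambda>x. f x + (-1) * h x) (\<lambda>x. f' x + (-1) * h' x)"
    by (rule is_weak_deriv_lincomb[OF f h])
  have "AE x in lebesgue_on {\<alpha><..<\<beta>}. f' x + (-1) * h' x = 0"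
  proof (rule AE_zero_if_test_integrals_zero)
    show "locally_integrable {\<alpha><..<\<beta>} (\<lambda>x. f' x + (-1) * h' x)"
      using d by (simp add: is_weak_deriv_def)
    fix \<psi> assume \<psi>: "test_function {\<alpha><..<\<beta>} \<psi>"
    have "(LINT x|lebesgue_on {\<alpha><..<\<beta>}. deriv \<psi> x *\<^sub>R (f x + (-1) * h x)) = 0"
      by (rule integral_eq_zero_AE) (use eq in \<open>auto elim: eventually_mono\<close>)
    then show "(LINT x|lebesgue_on {\<alpha><..<\<beta>}. \<psi> x *\<^sub>R (f' x + (-1) * h' x)) = 0"
      using d \<psi> by (simp add: is_weak_deriv_def)
  qed
  then show ?thesis by (auto elim: eventually_mono)
qed

lemma weak_deriv_is_weak_deriv:
  "is_weak_deriv \<Omega> f g \<Longrightarrow> is_weak_deriv \<Omega> f (weak_deriv \<Omega> f)"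
  unfolding weak_deriv_def by (rule someI[of "is_weak_deriv \<Omega> f"])

lemma weak_deriv_AE_eq:
  assumes "is_weak_deriv {\<alpha><..<\<beta>} f g"
  shows "AE x in lebesgue_on {\<alpha><..<\<beta>}. weak_deriv {\<alpha><..<\<beta>} f x = g x"
  by (rule is_weak_deriv_AE_unique[OF weak_deriv_is_weak_deriv[OF assms] assms]) simp

section \<open>The Luxemburg norm\<close>

locale orlicz_interval =
  fixes \<alpha> \<beta> :: real and \<phi> :: "real \<Rightarrow> real"
  assumes interval: "\<alpha> < \<beta>" and orlicz: "orlicz_function \<phi>"
begin

abbreviation \<Omega> :: "real set" where "\<Omega> \<equiv> {\<alpha><..<\<beta>}"
abbreviation M :: "real measure" where "M \<equiv> lebesgue_on \<Omega>"
abbreviation modular :: "(real \<Rightarrow> complex) \<Rightarrow> ennreal" where "modular \<equiv> orlicz_modular \<Omega> \<phi>"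
abbreviation lux :: "(real \<Rightarrow> complex) \<Rightarrow> ennreal" where "lux \<equiv> luxemburg_norm \<Omega> \<phi>"

lemma finite_measure_M: "finite_measure M"
  by (rule finite_measure_lebesgue_on) simp

lemma emeasure_M: "emeasure M (space M) = ennreal (\<beta> - \<alpha>)"
  using interval by (simp add: emeasure_restrict_space)

lemma phi_0: "\<phi> 0 = 0" and phi_nonneg: "t \<ge> 0 \<Longrightarrow> \<phi> t \<ge> 0" and phi_convex: "convex_on {0..} \<phi>"
  using orlicz by (auto simp: orlicz_function_def)

text \<open>
  Convexity enters mostly through this inequality and its mirror image below: since \<open>\<phi> 0 = 0\<close>,
  \<open>\<phi>\<close> lies below its chords through the origin.
\<close>

lemma phi_scale_le:
  assumes "0 \<le> s" "s \<le> 1" "t \<ge> 0" shows "\<phi> (s * t) \<le> s * \<phi> t"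
  using convex_onD[OF phi_convex, of s 0 t] assms by (simp add: phi_0)

lemma phi_scale_ge:
  assumes "s \<ge> 1" "t \<ge> 0" shows "s * \<phi> t \<le> \<phi> (s * t)"
proof -
  have "\<phi> (1 / s * (s * t)) \<le> 1 / s * \<phi> (s * t)"
    using assms by (intro phi_scale_le) auto
  then show ?thesis using assms by (simp add: field_simps)
qed

lemma phi_mono:
  assumes "0 \<le> s" "s \<le> t" shows "\<phi> s \<le> \<phi> t"
proof (cases "s = 0")
  case False
  then have "\<phi> (s / t * t) \<le> s / t * \<phi> t"
    using assms by (intro phi_scale_le) auto
  also have "\<dots> \<le> 1 * \<phi> t"
    using assms False by (intro mult_right_mono phi_nonneg) auto
  finally show ?thesis using assms False by simp
qed (use assms in \<open>auto simp: phi_0 intro: phi_nonneg\<close>)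

lemma phi_pos_ex: obtains t0 where "t0 > 0" "\<phi> t0 > 0"
proof -
  obtain t where "t \<ge> 0" "\<phi> t \<noteq> 0"
    using orlicz by (auto simp: orlicz_function_def)
  then show thesis
    using phi_0 phi_nonneg[of t] by (intro that[of t]) (auto simp: less_le)
qed

lemma phi_unbounded: obtains u where "u > 0" "\<phi> u \<ge> C"
proof -
  obtain t0 where t0: "t0 > 0" "\<phi> t0 > 0" by (rule phi_pos_ex)
  let ?s = "max 1 (C / \<phi> t0)"
  have "C \<le> ?s * \<phi> t0"
    using t0 by (metis max.cobounded2 pos_divide_le_eq)
  also have "\<dots> \<le> \<phi> (?s * t0)"
    using t0 by (intro phi_scale_ge) auto
  finally show thesis using t0 by (intro that[of "?s * t0"]) auto
qed

lemma phi_small: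
  assumes "e > 0" obtains c where "c > 0" "\<phi> c \<le> e"
proof -
  have "(\<phi> \<longlongrightarrow> 0) (at_right 0)" using orlicz by (simp add: orlicz_function_def)
  then have "eventually (\<lambda>c. dist (\<phi> c) 0 < e) (at_right 0)"
    using assms by (rule tendstoD)
  then obtain b where b: "b > 0" "\<And>c. 0 < c \<Longrightarrow> c < b \<Longrightarrow> dist (\<phi> c) 0 < e"
    by (auto simp: eventually_at_right_field)
  show thesis using b(1) b(2)[of "b / 2"] by (intro that[of "b / 2"]) auto
qed

lemma phi_measurable:
  assumes "f \<in> borel_measurable N"
  shows "(\<lambda>x. \<phi> (cmod (f x))) \<in> borel_measurable N"
proof -
  have "mono (\<lambda>t. \<phi> (max 0 t))"
    by (intro monoI phi_mono) auto
  then have "(\<lambda>t. \<phi> (max 0 t)) \<in> borel_measurable borel"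
    by (rule borel_measurable_mono)
  moreover have "(\<lambda>x. cmod (f x)) \<in> borel_measurable N"
    using assms by measurable
  ultimately have "(\<lambda>x. \<phi> (max 0 (cmod (f x)))) \<in> borel_measurable N"
    by (rule measurable_compose[rotated])
  then
  show ?thesis by (simp add: max_def)
qed

lemma modular_mono:
  assumes "AE x in M. cmod (f x) \<le> cmod (g x)"
  shows "modular f \<le> modular g"
  unfolding orlicz_modular_def
  by (rule nn_integral_mono_AE) (use assms in \<open>auto elim!: eventually_mono intro!: ennreal_leI phi_mono\<close>)

lemma lux_le: "0 < l \<Longrightarrow> modular (\<lambda>x. f x / of_real l) \<le> 1 \<Longrightarrow> lux f \<le> ennreal l"
  unfolding luxemburg_norm_def by (rule INF_lower) auto

text \<open>
  Together with \<open>lux_le\<close> this replaces the attainment of the infimum in the Luxemburg norm by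
  monotonicity of the modular: every number above the norm is admissible.
\<close>

lemma lux_lessD:
  assumes "lux f < ennreal l"
  shows "0 < l" "modular (\<lambda>x. f x / of_real l) \<le> 1"
proof -
  obtain k where k: "0 < k" "modular (\<lambda>x. f x / of_real k) \<le> 1" "ennreal k < ennreal l"
    using assms unfolding luxemburg_norm_def INF_less_iff by auto
  then have "k < l"
    by (metis ennreal_leI not_le)
  then show "0 < l" using k by simp
  have "modular (\<lambda>x. f x / of_real l) \<le> modular (\<lambda>x. f x / of_real k)"
    using k \<open>k < l\<close> by (intro modular_mono AE_I2) (auto simp: norm_divide intro!: divide_left_mono)
  then show "modular (\<lambda>x. f x / of_real l) \<le> 1" using k by simp
qed

lemma lux_mono:
  assumes "AE x in M. cmod (f x) \<le> cmod (g x)"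
  shows "lux f \<le> lux g"
  unfolding luxemburg_norm_def
proof (rule INF_superset_mono)
  show "{l. 0 < l \<and> modular (\<lambda>x. g x / of_real l) \<le> 1} \<subseteq> {l. 0 < l \<and> modular (\<lambda>x. f x / of_real l) \<le> 1}"
  proof safe
    fix l :: real assume l: "0 < l" "modular (\<lambda>x. g x / of_real l) \<le> 1"
    have "modular (\<lambda>x. f x / of_real l) \<le> modular (\<lambda>x. g x / of_real l)"
      using assms l(1) by (intro modular_mono) (auto elim!: eventually_mono simp: norm_divide divide_right_mono)
    then show "modular (\<lambda>x. f x / of_real l) \<le> 1" using l(2) by simp
  qed
qed auto

lemma lux_cong: "AE x in M. cmod (f x) = cmod (g x) \<Longrightarrow> lux f = lux g"
  by (intro antisym lux_mono) (auto elim: eventually_mono)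

text \<open>
  If \<open>a\<close> and \<open>b\<close> are admissible for \<open>f\<close> and \<open>g\<close>, then \<open>(f + g)/(a + b)\<close> is the convex combination
  of \<open>f/a\<close> and \<open>g/b\<close> with weights \<open>a/(a + b)\<close> and \<open>b/(a + b)\<close>, so \<open>a + b\<close> is admissible for the sum.
\<close>

lemma lux_triangle:
  assumes [measurable]: "f \<in> borel_measurable M" "g \<in> borel_measurable M"
  shows "lux (\<lambda>x. f x + g x) \<le> lux f + lux g"
proof (rule ennreal_le_epsilon)
  fix e :: real assume fin: "lux f + lux g < top" and e: "0 < e"
  define a where "a = enn2real (lux f) + e / 2"
  define b where "b = enn2real (lux g) + e / 2"
  have f: "lux f = ennreal (enn2real (lux f))" and g: "lux g = ennreal (enn2real (lux g))"
    using fin by (auto simp: less_top)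
  have la: "lux f < ennreal a" and lb: "lux g < ennreal b"
    using e by (subst f, simp add: a_def ennreal_less_iff, subst g, simp add: b_def ennreal_less_iff)
  note A = lux_lessD[OF la] and B = lux_lessD[OF lb]
  let ?s = "a / (a + b)" and ?t = "b / (a + b)"
  have st: "?s \<ge> 0" "?t \<ge> 0" "?s + ?t = 1"
    using A(1) B(1) by (auto simp flip: add_divide_distrib)
  have "modular (\<lambda>x. (f x + g x) / of_real (a + b)) \<le>
     (\<integral>\<^sup>+x. ennreal ?s * ennreal (\<phi> (cmod (f x / of_real a))) + ennreal ?t * ennreal (\<phi> (cmod (g x / of_real b))) \<partial>M)"
    unfolding orlicz_modular_def
  proof (rule nn_integral_mono)
    fix x
    let ?u = "cmod (f x / of_real a)" and ?v = "cmod (g x / of_real b)"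
    have "cmod ((f x + g x) / of_real (a + b)) = cmod (f x + g x) / (a + b)"
      using A(1) B(1) by (simp add: norm_divide del: of_real_add)
    also have "\<dots> \<le> (cmod (f x) + cmod (g x)) / (a + b)"
      using A(1) B(1) by (intro divide_right_mono norm_triangle_ineq) auto
    also have "\<dots> = ?s * ?u + ?t * ?v"
      using A(1) B(1) by (simp add: norm_divide add_divide_distrib)
    finally have "\<phi> (cmod ((f x + g x) / of_real (a + b))) \<le> \<phi> (?s * ?u + ?t * ?v)"
      by (intro phi_mono) auto
    also have "\<dots> \<le> ?s * \<phi> ?u + ?t * \<phi> ?v"
      using phi_convex st unfolding convex_on_def by (metis norm_ge_zero atLeast_iff real_scaleR_def)
    finally have "ennreal (\<phi> (cmod ((f x + g x) / of_real (a + b)))) \<le> ennreal (?s * \<phi> ?u + ?t * \<phi> ?v)"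
      by (rule ennreal_leI)
    also have "\<dots> = ennreal ?s * ennreal (\<phi> ?u) + ennreal ?t * ennreal (\<phi> ?v)"
      using st phi_nonneg[of ?u] phi_nonneg[of ?v]
      by (simp only: ennreal_plus mult_nonneg_nonneg norm_ge_zero ennreal_mult)
    finally show "ennreal (\<phi> (cmod ((f x + g x) / of_real (a + b)))) \<le>
        ennreal ?s * ennreal (\<phi> ?u) + ennreal ?t * ennreal (\<phi> ?v)" .
  qed
  also have "\<dots> = ennreal ?s * modular (\<lambda>x. f x / of_real a) + ennreal ?t * modular (\<lambda>x. g x / of_real b)"
  proof -
    have [measurable]: "(\<lambda>x. \<phi> (cmod (f x / of_real a))) \<in> borel_measurable M"
      "(\<lambda>x. \<phi> (cmod (g x / of_real b))) \<in> borel_measurable M"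
      by (auto intro!: phi_measurable)
    show ?thesis
      unfolding orlicz_modular_def by (simp add: nn_integral_add nn_integral_cmult)
  qed
  also have "\<dots> \<le> ennreal ?s * 1 + ennreal ?t * 1"
    using A(2) B(2) by (intro add_mono mult_left_mono) auto
  also have "\<dots> = 1"
    using st by (simp flip: ennreal_plus)
  finally have "lux (\<lambda>x. f x + g x) \<le> ennreal (a + b)"
    using A(1) B(1) by (intro lux_le) auto
  also have "\<dots> = lux f + lux g + ennreal e"
    using e by (subst f, subst g) (simp add: a_def b_def flip: ennreal_plus)
  finally show "lux (\<lambda>x. f x + g x) \<le> lux f + lux g + ennreal e" .
qed

lemma lux_scale_finite:
  assumes "lux f < \<infinity>" shows "lux (\<lambda>x. c * f x) < \<infinity>"
proof -
  obtain r where "r \<ge> 0" "lux f = ennreal r"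
    using assms by (cases "lux f") auto
  then obtain l where "lux f < ennreal l"
    by (metis ennreal_less_iff less_add_one)
  note l = lux_lessD[OF this]
  let ?k = "(cmod c + 1) * l"
  have "?k > 0" using l(1) by (intro mult_pos_pos add_nonneg_pos) auto
  have "cmod (c * f x / of_real ?k) \<le> cmod (f x / of_real l)" for x
  proof -
    have "cmod (c * f x / of_real ?k) = (cmod c / (cmod c + 1)) * cmod (f x / of_real l)"
      using l(1) by (simp add: norm_divide norm_mult abs_mult del: of_real_add of_real_mult)
    also have "\<dots> \<le> 1 * cmod (f x / of_real l)"
    proof (rule mult_right_mono)
      have "cmod c + 1 > 0" by (simp add: add_nonneg_pos)
      then show "cmod c / (cmod c + 1) \<le> 1" by simp
    qed simp
    finally show ?thesis by simp
  qed
  then have "modular (\<lambda>x. c * f x / of_real ?k) \<le> modular (\<lambda>x. f x / of_real l)"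
    by (intro modular_mono AE_I2)
  then have "lux (\<lambda>x. c * f x) \<le> ennreal ?k"
    using l \<open>?k > 0\<close> by (intro lux_le) auto
  then show ?thesis by (simp add: le_less_trans less_top)
qed

text \<open>
  A convex function that is not identically zero grows at least linearly. Integrating the linear lower bound
  over the bounded interval gives the continuous inclusion of \<open>L\<^sup>\<phi>\<close> in \<open>L\<^sup>1\<close>.
\<close>

lemma L1_le_lux:
  obtains K where "K > 0"
    "\<And>f l. f \<in> borel_measurable M \<Longrightarrow> lux f < ennreal l \<Longrightarrow> (\<integral>\<^sup>+x. norm (f x) \<partial>M) \<le> ennreal (K * l)"
proof -
  obtain t0 where t0: "t0 > 0" "\<phi> t0 > 0" by (rule phi_pos_ex)
  let ?K = "t0 * (\<beta> - \<alpha>) + t0 / \<phi> t0"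
  \<comment> \<open>Beyond t0 the function lies above the line through the origin and its value at t0.\<close>
  have lin: "t \<le> t0 + t0 / \<phi> t0 * \<phi> t" if "t \<ge> 0" for t
  proof (cases "t \<le> t0")
    case True
    then show ?thesis using t0 phi_nonneg[OF that] by (simp add: add_increasing2)
  next
    case False
    then have "t / t0 * \<phi> t0 \<le> \<phi> (t / t0 * t0)"
      using t0 by (intro phi_scale_ge) auto
    then have "t \<le> t0 / \<phi> t0 * \<phi> t" using t0 by (simp add: field_simps)
    then show ?thesis using t0 by linarith
  qed
  show thesis
  proof (rule that[of ?K])
    show "?K > 0" using t0 interval by (intro add_pos_pos mult_pos_pos) auto
    fix f l assume f[measurable]: "f \<in> borel_measurable M" and "lux f < ennreal l"
    note l = lux_lessD[OF this(2)]
    have [measurable]: "(\<lambda>x. \<phi> (cmod (f x / of_real l))) \<in> borel_measurable M"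
      by (auto intro!: phi_measurable)
    have "(\<integral>\<^sup>+x. norm (f x) \<partial>M) \<le>
      (\<integral>\<^sup>+x. ennreal l * (ennreal t0 + ennreal (t0 / \<phi> t0) * ennreal (\<phi> (cmod (f x / of_real l)))) \<partial>M)"
    proof (rule nn_integral_mono)
      fix x
      have "norm (f x) = l * cmod (f x / of_real l)"
        using l(1) by (simp add: norm_divide)
      also have "\<dots> \<le> l * (t0 + t0 / \<phi> t0 * \<phi> (cmod (f x / of_real l)))"
        using l(1) by (intro mult_left_mono lin) auto
      finally have "ennreal (norm (f x)) \<le> ennreal (l * (t0 + t0 / \<phi> t0 * \<phi> (cmod (f x / of_real l))))"
        by (rule ennreal_leI)
      also have "\<dots> = ennreal l * (ennreal t0 + ennreal (t0 / \<phi> t0) * ennreal (\<phi> (cmod (f x / of_real l))))"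
        using l(1) t0 phi_nonneg[of "cmod (f x / of_real l)"]
        by (simp only: ennreal_plus ennreal_mult mult_nonneg_nonneg add_nonneg_nonneg divide_nonneg_nonneg less_imp_le norm_ge_zero)
      finally show "ennreal (norm (f x)) \<le> ennreal l * (ennreal t0 + ennreal (t0 / \<phi> t0) * ennreal (\<phi> (cmod (f x / of_real l))))" .
    qed
    also have "\<dots> = ennreal l * (ennreal t0 * ennreal (\<beta> - \<alpha>) + ennreal (t0 / \<phi> t0) * modular (\<lambda>x. f x / of_real l))"
      using emeasure_M by (simp add: nn_integral_cmult nn_integral_add orlicz_modular_def)
    also have "\<dots> \<le> ennreal l * (ennreal t0 * ennreal (\<beta> - \<alpha>) + ennreal (t0 / \<phi> t0) * 1)"
      using l(2) by (intro mult_left_mono add_mono) auto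
    also have "\<dots> = ennreal (?K * l)"
      using l(1) t0 interval by (simp add: mult.commute flip: ennreal_mult ennreal_plus)
    finally show "(\<integral>\<^sup>+x. norm (f x) \<partial>M) \<le> ennreal (?K * l)" .
  qed
qed

lemma lux_eq_0D:
  assumes f [measurable]: "f \<in> borel_measurable M" and "lux f = 0"
  shows "AE x in M. f x = 0"
proof -
  obtain K where K: "K > 0"
    "\<And>f l. f \<in> borel_measurable M \<Longrightarrow> lux f < ennreal l \<Longrightarrow> (\<integral>\<^sup>+x. norm (f x) \<partial>M) \<le> ennreal (K * l)"
    using L1_le_lux by blast
  have "(\<integral>\<^sup>+x. norm (f x) \<partial>M) \<le> 0 + ennreal e" if "e > 0" for e :: real
    using K(2)[OF f, of "e / K"] K(1) assms(2) that by simp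
  then have "(\<integral>\<^sup>+x. norm (f x) \<partial>M) \<le> 0"
    by (rule ennreal_le_epsilon)
  then have "(\<integral>\<^sup>+x. norm (f x) \<partial>M) = 0" by simp
  then have "AE x in M. ennreal (norm (f x)) = 0"
    by (subst (asm) nn_integral_0_iff_AE) auto
  then show ?thesis by simp
qed

section \<open>The Orlicz--Sobolev space as a metric space\<close>

abbreviation sob :: "(real \<Rightarrow> complex) set" where "sob \<equiv> sobolev_functions \<Omega> \<phi>"
abbreviation snorm :: "(real \<Rightarrow> complex) \<Rightarrow> ennreal" where "snorm \<equiv> sobolev_norm \<Omega> \<phi>"
abbreviation X :: "(real \<Rightarrow> complex) set cnormed" where "X \<equiv> orlicz_sobolev \<Omega> \<phi>"
abbreviation cls :: "(real \<Rightarrow> complex) \<Rightarrow> (real \<Rightarrow> complex) set" where "cls f \<equiv> ae_eq \<Omega> \<phi> `` {f}"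

text \<open>
  The norm does not depend on the representative of the weak derivative selected in its definition,
  so any weak derivative at hand may be used to compute it.
\<close>

lemma sobolev_norm_eq:
  assumes "is_weak_deriv \<Omega> f g" shows "snorm f = lux f + lux g"
proof -
  have "lux (weak_deriv \<Omega> f) = lux g"
    using weak_deriv_AE_eq[OF assms] by (intro lux_cong) (auto elim: eventually_mono)
  then show ?thesis by (simp add: sobolev_norm_def)
qed

lemma sobolev_functionsI:
  "is_weak_deriv \<Omega> f g \<Longrightarrow> lux f + lux g < \<infinity> \<Longrightarrow> f \<in> sob"
  using sobolev_norm_eq[of f g] by (auto simp: sobolev_functions_def is_weak_deriv_def)

lemma sobolev_functionsD:
  assumes "f \<in> sob"
  shows "is_weak_deriv \<Omega> f (weak_deriv \<Omega> f)" "lux f < \<infinity>" "lux (weak_deriv \<Omega> f) < \<infinity>" "snorm f < \<infinity>"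
    "f \<in> borel_measurable M" "weak_deriv \<Omega> f \<in> borel_measurable M"
proof -
  show wd: "is_weak_deriv \<Omega> f (weak_deriv \<Omega> f)"
    using assms by (auto simp: sobolev_functions_def intro: weak_deriv_is_weak_deriv)
  show fin: "snorm f < \<infinity>"
    using assms by (simp add: sobolev_functions_def)
  then show "lux f < \<infinity>" "lux (weak_deriv \<Omega> f) < \<infinity>"
    by (auto simp: sobolev_norm_def)
  show "f \<in> borel_measurable M" "weak_deriv \<Omega> f \<in> borel_measurable M"
    using wd by (auto simp: is_weak_deriv_def intro: locally_integrable_measurable)
qed

lemma lux_lincomb_finite:
  assumes "f \<in> borel_measurable M" "h \<in> borel_measurable M" "lux f < \<infinity>" "lux h < \<infinity>"
  shows "lux (\<lambda>x. f x + c * h x) < \<infinity>"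
proof -
  have "lux (\<lambda>x. f x + c * h x) \<le> lux f + lux (\<lambda>x. c * h x)"
    using assms by (intro lux_triangle) auto
  also have "\<dots> < \<infinity>"
    using assms lux_scale_finite[of h c] by simp
  finally show ?thesis .
qed

lemma sob_lincomb:
  assumes f: "f \<in> sob" and h: "h \<in> sob"
  shows "(\<lambda>x. f x + c * h x) \<in> sob"
  using sobolev_functionsD[OF f] sobolev_functionsD[OF h]
    lux_lincomb_finite[of f h c] lux_lincomb_finite[of "weak_deriv \<Omega> f" "weak_deriv \<Omega> h" c]
  by (intro sobolev_functionsI[OF is_weak_deriv_lincomb[OF sobolev_functionsD(1)[OF f] sobolev_functionsD(1)[OF h]]]) auto

lemma zero_weak_deriv: "is_weak_deriv \<Omega> (\<lambda>x. 0) (\<lambda>x. 0)"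
  by (simp add: is_weak_deriv_def locally_integrable_def)

lemma lux_zero: "lux (\<lambda>x. 0) = 0"
proof -
  have "lux (\<lambda>x. 0) \<le> 0 + ennreal e" if "e > 0" for e
    using that by (simp add: lux_le orlicz_modular_def phi_0)
  then have "lux (\<lambda>x. 0) \<le> 0" by (rule ennreal_le_epsilon)
  then show ?thesis by simp
qed

lemma sob_zero: "(\<lambda>x. 0) \<in> sob"
  by (rule sobolev_functionsI[OF zero_weak_deriv]) (simp add: lux_zero)

lemma sob_add: "f \<in> sob \<Longrightarrow> h \<in> sob \<Longrightarrow> (\<lambda>x. f x + h x) \<in> sob"
  using sob_lincomb[of f h 1] by simp

lemma sob_scale: "f \<in> sob \<Longrightarrow> (\<lambda>x. c * f x) \<in> sob"
  using sob_lincomb[OF sob_zero, of f c] by simp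

lemma sob_diff: "f \<in> sob \<Longrightarrow> h \<in> sob \<Longrightarrow> (\<lambda>x. f x - h x) \<in> sob"
  using sob_lincomb[of f h "-1"] by simp

lemma is_weak_deriv_diff:
  assumes f: "f \<in> sob" and h: "h \<in> sob"
  shows "is_weak_deriv \<Omega> (\<lambda>x. f x - h x) (\<lambda>x. weak_deriv \<Omega> f x - weak_deriv \<Omega> h x)"
  using is_weak_deriv_lincomb[OF sobolev_functionsD(1)[OF f] sobolev_functionsD(1)[OF h], of "-1"] by simp

lemma snorm_diff:
  assumes "f \<in> sob" "h \<in> sob"
  shows "snorm (\<lambda>x. f x - h x) = lux (\<lambda>x. f x - h x) + lux (\<lambda>x. weak_deriv \<Omega> f x - weak_deriv \<Omega> h x)"
  by (rule sobolev_norm_eq[OF is_weak_deriv_diff[OF assms]])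

lemma lux_minus_commute: "lux (\<lambda>x. f x - h x) = lux (\<lambda>x. h x - f x)"
  by (rule lux_cong) (simp add: norm_minus_commute)

lemma lux_triangle_diff:
  assumes [measurable]: "f \<in> borel_measurable M" "g \<in> borel_measurable M" "h \<in> borel_measurable M"
  shows "lux (\<lambda>x. f x - h x) \<le> lux (\<lambda>x. f x - g x) + lux (\<lambda>x. g x - h x)"
  using lux_triangle[of "\<lambda>x. f x - g x" "\<lambda>x. g x - h x"] by simp

lemma snorm_AE_cong:
  assumes "f \<in> sob" "h \<in> sob" "AE x in M. f x = h x"
  shows "snorm f = snorm h"
proof -
  have "AE x in M. weak_deriv \<Omega> f x = weak_deriv \<Omega> h x"
    using assms by (intro is_weak_deriv_AE_unique[OF _ _ assms(3)] sobolev_functionsD)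
  then have "lux (weak_deriv \<Omega> f) = lux (weak_deriv \<Omega> h)"
    by (intro lux_cong) (auto elim: eventually_mono)
  moreover have "lux f = lux h"
    using assms by (intro lux_cong) (auto elim: eventually_mono)
  ultimately show ?thesis by (simp add: sobolev_norm_def)
qed

lemma equiv_ae_eq: "equiv sob (ae_eq \<Omega> \<phi>)"
proof (rule equivI)
  show "ae_eq \<Omega> \<phi> \<subseteq> sob \<times> sob" by (auto simp: ae_eq_def)
  show "refl_on sob (ae_eq \<Omega> \<phi>)" by (auto simp: ae_eq_def refl_on_def)
  show "sym (ae_eq \<Omega> \<phi>)" by (auto simp: ae_eq_def sym_def elim: eventually_mono)
  show "trans (ae_eq \<Omega> \<phi>)"
    unfolding trans_def ae_eq_def by (auto elim: eventually_elim2)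
qed

lemma ae_eq_iff: "(f, h) \<in> ae_eq \<Omega> \<phi> \<longleftrightarrow> f \<in> sob \<and> h \<in> sob \<and> (AE x in M. f x = h x)"
  by (auto simp: ae_eq_def)

lemma cls_eqI: "f \<in> sob \<Longrightarrow> h \<in> sob \<Longrightarrow> AE x in M. f x = h x \<Longrightarrow> cls f = cls h"
  by (rule equiv_class_eq[OF equiv_ae_eq]) (simp add: ae_eq_def)

lemma cls_eqD: "f \<in> sob \<Longrightarrow> h \<in> sob \<Longrightarrow> cls f = cls h \<Longrightarrow> AE x in M. f x = h x"
  using eq_equiv_class_iff[OF equiv_ae_eq, of f h] by (auto simp: ae_eq_def)

lemma carr_X: "carr X = cls ` sob"
  by (auto simp: orlicz_sobolev_def quotient_def)

lemma UN_cls_const: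
  assumes "f \<in> sob" "\<And>h. h \<in> cls f \<Longrightarrow> F h = C"
  shows "(\<Union>h\<in>cls f. F h) = C"
proof -
  have "f \<in> cls f" using assms(1) by (simp add: ae_eq_iff)
  then show ?thesis using assms(2) by blast
qed

lemma add_cls:
  assumes f: "f \<in> sob" and h: "h \<in> sob"
  shows "add X (cls f) (cls h) = cls (\<lambda>x. f x + h x)"
proof -
  have eq: "cls (\<lambda>x. f' x + h' x) = cls (\<lambda>x. f x + h x)" if "f' \<in> cls f" "h' \<in> cls h" for f' h'
    using that by (intro cls_eqI) (auto simp: ae_eq_iff intro!: sob_add elim: eventually_elim2)
  have "(\<Union>f'\<in>cls f. \<Union>h'\<in>cls h. cls (\<lambda>x. f' x + h' x)) = cls (\<lambda>x. f x + h x)"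
    by (intro UN_cls_const f h eq)
  then show ?thesis by (simp add: orlicz_sobolev_def)
qed

lemma smult_cls:
  assumes f: "f \<in> sob"
  shows "smult X c (cls f) = cls (\<lambda>x. c * f x)"
proof -
  have "(\<Union>f'\<in>cls f. cls (\<lambda>x. c * f' x)) = cls (\<lambda>x. c * f x)"
  proof (rule UN_cls_const[OF f])
    fix f' assume "f' \<in> cls f"
    then have f': "f' \<in> sob" "AE x in M. f x = f' x" by (auto simp: ae_eq_iff)
    from f'(2) have "AE x in M. c * f' x = c * f x"
      by (rule eventually_mono) simp
    then show "cls (\<lambda>x. c * f' x) = cls (\<lambda>x. c * f x)"
      using f f' by (intro cls_eqI sob_scale)
  qed
  then show ?thesis by (simp add: orlicz_sobolev_def)
qed

lemma nrm_cls:
  assumes f: "f \<in> sob"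
  shows "nrm X (cls f) = enn2real (snorm f)"
proof -
  have "f \<in> cls f" using f by (simp add: ae_eq_iff)
  moreover have "snorm h = snorm f" if "h \<in> cls f" for h
    using that by (intro snorm_AE_cong) (auto simp: ae_eq_iff elim: eventually_mono)
  ultimately have "snorm ` cls f = {snorm f}" by blast
  then show ?thesis by (simp add: orlicz_sobolev_def)
qed

text \<open>
  On any set of classes the distance is computed from representatives; both directions of the theorem
  work with functions through this formula.
\<close>

lemma norm_dist_cls:
  assumes V: "V \<subseteq> carr X" and f: "f \<in> sob" "cls f \<in> V" and h: "h \<in> sob" "cls h \<in> V"
  shows "norm_dist (X\<lparr>carr := V\<rparr>) (cls f) (cls h) = enn2real (snorm (\<lambda>x. f x - h x))"
proof -
  have "norm_dist (X\<lparr>carr := V\<rparr>) (cls f) (cls h) = nrm X (add X (cls f) (smult X (-1) (cls h)))"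
    using f h by (simp add: norm_dist_def)
  also have "\<dots> = nrm X (cls (\<lambda>x. f x + - 1 * h x))"
    using f h by (simp only: smult_cls add_cls sob_scale)
  also have "\<dots> = enn2real (snorm (\<lambda>x. f x - h x))"
    using sob_diff[OF f(1) h(1)] by (simp add: nrm_cls)
  finally show ?thesis .
qed

text \<open>
  Stated for arbitrary sets of classes, because the topology of a subspace is defined from the norm on
  that subspace.
\<close>

lemma Metric_space_subset:
  assumes V: "V \<subseteq> carr X"
  shows "Metric_space V (norm_dist (X\<lparr>carr := V\<rparr>))"
proof -
  let ?d = "norm_dist (X\<lparr>carr := V\<rparr>)"
  have rep: "\<exists>f. f \<in> sob \<and> u = cls f" if "u \<in> V" for u
    using that V by (auto simp: carr_X)
  have fin: "snorm (\<lambda>x. f x - h x) < \<infinity>" if "f \<in> sob" "h \<in> sob" for f h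
    by (rule sobolev_functionsD(4)[OF sob_diff[OF that]])
  show ?thesis
  proof
    fix u v
    consider "u \<in> V \<and> v \<in> V" | "\<not> (u \<in> V \<and> v \<in> V)" by blast
    then have "0 \<le> ?d u v \<and> ?d u v = ?d v u"
    proof cases
      case 1
      then obtain f h where "f \<in> sob" "u = cls f" "h \<in> sob" "v = cls h" using rep by metis
      then show ?thesis
        using 1 norm_dist_cls[OF V] lux_minus_commute[of f h]
          lux_minus_commute[of "weak_deriv \<Omega> f" "weak_deriv \<Omega> h"]
        by (simp add: snorm_diff)
    qed (auto simp: norm_dist_def)
    then show "0 \<le> ?d u v" "?d u v = ?d v u" by auto
  next
    fix u v assume uv: "u \<in> V" "v \<in> V"
    then obtain f h where fh: "f \<in> sob" "u = cls f" "h \<in> sob" "v = cls h" using rep by metis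
    have d: "?d u v = enn2real (snorm (\<lambda>x. f x - h x))"
      using uv fh norm_dist_cls[OF V] by simp
    show "?d u v = 0 \<longleftrightarrow> u = v"
    proof
      assume "?d u v = 0"
      then have "lux (\<lambda>x. f x - h x) = 0"
        using d fin[OF fh(1,3)] snorm_diff[OF fh(1,3)] by (auto simp: enn2real_eq_0_iff)
      then have "AE x in M. f x - h x = 0"
        using fh sobolev_functionsD(5) by (intro lux_eq_0D) auto
      then have "AE x in M. f x = h x" by simp
      then show "u = v" using cls_eqI[OF fh(1,3)] fh(2,4) by simp
    next
      assume "u = v"
      then have "AE x in M. f x = h x" using fh cls_eqD by auto
      then have "snorm (\<lambda>x. f x - h x) = snorm (\<lambda>x. 0)"
        using fh by (intro snorm_AE_cong sob_diff sob_zero) auto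
      also have "\<dots> = 0" by (simp add: sobolev_norm_eq[OF zero_weak_deriv] lux_zero)
      finally show "?d u v = 0" using d by simp
    qed
  next
    fix u v w assume uvw: "u \<in> V" "v \<in> V" "w \<in> V"
    then obtain f g h where r: "f \<in> sob" "u = cls f" "g \<in> sob" "v = cls g" "h \<in> sob" "w = cls h"
      using rep by metis
    note m = sobolev_functionsD(5,6)
    have "snorm (\<lambda>x. f x - h x) \<le> snorm (\<lambda>x. f x - g x) + snorm (\<lambda>x. g x - h x)"
      using add_mono[OF lux_triangle_diff[OF m(1)[OF r(1)] m(1)[OF r(3)] m(1)[OF r(5)]]
          lux_triangle_diff[OF m(2)[OF r(1)] m(2)[OF r(3)] m(2)[OF r(5)]]] r
      by (simp add: snorm_diff add_ac)
    then have "enn2real (snorm (\<lambda>x. f x - h x)) \<le> enn2real (snorm (\<lambda>x. f x - g x) + snorm (\<lambda>x. g x - h x))"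
      using fin r by (intro enn2real_mono) auto
    also have "\<dots> = enn2real (snorm (\<lambda>x. f x - g x)) + enn2real (snorm (\<lambda>x. g x - h x))"
      using fin r by (intro enn2real_plus) auto
    finally show "?d u w \<le> ?d u v + ?d v w"
      using uvw r norm_dist_cls[OF V] by simp
  qed
qed

end

section \<open>The sequence space and bi-Lipschitz isomorphisms\<close>

lemma ell_infty_simps:
  "carr ell_infty = {x. bounded (range x)}"
  "add ell_infty x y = (\<lambda>n. x n + y n)" "smult ell_infty c x = (\<lambda>n. c * x n)"
  by (auto simp: ell_infty_def)

lemma ell_infty_lincomb:
  assumes "x \<in> carr ell_infty" "y \<in> carr ell_infty"
  shows "(\<lambda>n. x n + c * y n) \<in> carr ell_infty"
proof -
  obtain B C where "\<And>n. norm (x n) \<le> B" "\<And>n. norm (y n) \<le> C"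
    using assms by (auto simp: ell_infty_simps bounded_iff)
  then have "norm (x n + c * y n) \<le> B + norm c * C" for n
    by (intro order_trans[OF norm_triangle_ineq] add_mono) (auto simp: norm_mult intro: mult_left_mono)
  then show ?thesis by (auto simp: ell_infty_simps bounded_iff)
qed

lemma ell_infty_dist:
  assumes "x \<in> carr ell_infty" "y \<in> carr ell_infty"
  shows "norm_dist ell_infty x y = (SUP n. cmod (x n - y n))"
  using assms by (simp add: norm_dist_def ell_infty_def)

lemma ell_infty_dist_ge:
  assumes "x \<in> carr ell_infty" "y \<in> carr ell_infty"
  shows "cmod (x n - y n) \<le> norm_dist ell_infty x y"
proof -
  have "bounded (range (\<lambda>n. x n - y n))"
    using ell_infty_lincomb[OF assms, of "-1"] by (simp add: ell_infty_simps)
  then have "bdd_above (range (\<lambda>n. cmod (x n - y n)))"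
    by (auto simp: bounded_iff bdd_above_def)
  then show ?thesis
    unfolding ell_infty_dist[OF assms] by (intro cSUP_upper) auto
qed

lemma ell_infty_dist_le:
  assumes "x \<in> carr ell_infty" "y \<in> carr ell_infty" "\<And>n. cmod (x n - y n) \<le> C"
  shows "norm_dist ell_infty x y \<le> C"
  unfolding ell_infty_dist[OF assms(1,2)] using assms(3) by (intro cSUP_least) auto

lemma Metric_space_ell_infty: "Metric_space (carr ell_infty) (norm_dist ell_infty)"
proof
  fix x y :: "nat \<Rightarrow> complex"
  consider "x \<in> carr ell_infty \<and> y \<in> carr ell_infty" | "\<not> (x \<in> carr ell_infty \<and> y \<in> carr ell_infty)" by blast
  then have "0 \<le> norm_dist ell_infty x y \<and> norm_dist ell_infty x y = norm_dist ell_infty y x"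
  proof cases
    case 1
    then have "0 \<le> norm_dist ell_infty x y"
      using order_trans[OF norm_ge_zero ell_infty_dist_ge[of x y 0]] by blast
    with 1 show ?thesis by (simp add: ell_infty_dist norm_minus_commute)
  qed (auto simp: norm_dist_def)
  then show "0 \<le> norm_dist ell_infty x y" "norm_dist ell_infty x y = norm_dist ell_infty y x" by auto
next
  fix x y :: "nat \<Rightarrow> complex" assume xy: "x \<in> carr ell_infty" "y \<in> carr ell_infty"
  show "norm_dist ell_infty x y = 0 \<longleftrightarrow> x = y"
    using ell_infty_dist_ge[OF xy] ell_infty_dist[OF xy] by auto
next
  fix x y z :: "nat \<Rightarrow> complex"
  assume xyz: "x \<in> carr ell_infty" "y \<in> carr ell_infty" "z \<in> carr ell_infty"
  show "norm_dist ell_infty x z \<le> norm_dist ell_infty x y + norm_dist ell_infty y z"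
  proof (rule ell_infty_dist_le[OF xyz(1,3)])
    fix n
    have "cmod (x n - z n) \<le> cmod (x n - y n) + cmod (y n - z n)"
      using norm_triangle_ineq[of "x n - y n" "y n - z n"] by simp
    also have "\<dots> \<le> norm_dist ell_infty x y + norm_dist ell_infty y z"
      by (intro add_mono ell_infty_dist_ge xyz)
    finally show "cmod (x n - z n) \<le> norm_dist ell_infty x y + norm_dist ell_infty y z" .
  qed
qed

lemma Lipschitz_imp_continuous_map:
  assumes "Metric_space A d" "Metric_space B e" "f ` A \<subseteq> B"
    and lip: "\<And>x y. x \<in> A \<Longrightarrow> y \<in> A \<Longrightarrow> e (f x) (f y) \<le> C * d x y" and "C > 0"
  shows "continuous_map (Metric_space.mtopology A d) (Metric_space.mtopology B e) f"
  unfolding Metric_space.metric_continuous_map[OF assms(1,2)]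
proof (intro conjI ballI allI impI)
  fix a \<epsilon> :: real and x assume "x \<in> A" "\<epsilon> > (0::real)"
  then show "\<exists>\<delta>>0. \<forall>y. y \<in> A \<and> d x y < \<delta> \<longrightarrow> e (f x) (f y) < \<epsilon>"
    using \<open>C > 0\<close> lip
    by (intro exI[of _ "\<epsilon> / C"]) (auto simp: field_simps intro: le_less_trans)
qed (use assms in auto)

text \<open>
  The linear map is given from \<open>Y\<close> onto \<open>X\<close>, the direction in which an embedding is constructed; the
  isomorphism is its inverse. The lower bound makes it injective.
\<close>

lemma isomorphic_spacesI_bilipschitz:
  assumes X: "Metric_space (carr X) (norm_dist X)" and Y: "Metric_space (carr Y) (norm_dist Y)"
    and Y_closed: "\<And>x y. x \<in> carr Y \<Longrightarrow> y \<in> carr Y \<Longrightarrow> add Y x y \<in> carr Y"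
      "\<And>c x. x \<in> carr Y \<Longrightarrow> smult Y c x \<in> carr Y"
    and S: "S ` carr Y = carr X"
    and lin: "\<And>x y. x \<in> carr Y \<Longrightarrow> y \<in> carr Y \<Longrightarrow> S (add Y x y) = add X (S x) (S y)"
      "\<And>c x. x \<in> carr Y \<Longrightarrow> S (smult Y c x) = smult X c (S x)"
    and upper: "\<And>x y. x \<in> carr Y \<Longrightarrow> y \<in> carr Y \<Longrightarrow> norm_dist X (S x) (S y) \<le> C * norm_dist Y x y"
    and lower: "\<And>x y. x \<in> carr Y \<Longrightarrow> y \<in> carr Y \<Longrightarrow> norm_dist Y x y \<le> D * norm_dist X (S x) (S y)"
    and "C > 0" "D > 0"
  shows "isomorphic_spaces X Y"
proof -
  interpret X: Metric_space "carr X" "norm_dist X" by (rule X)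
  interpret Y: Metric_space "carr Y" "norm_dist Y" by (rule Y)
  define T where "T = inv_into (carr Y) S"
  have inj: "inj_on S (carr Y)"
  proof (rule inj_onI)
    fix x y assume xy: "x \<in> carr Y" "y \<in> carr Y" "S x = S y"
    then have "S y \<in> carr X" using S by auto
    then have "norm_dist X (S x) (S y) = 0" using xy by simp
    then have "norm_dist Y x y \<le> 0" using lower[OF xy(1,2)] by simp
    then show "x = y" using xy by (metis Y.nonneg Y.zero antisym)
  qed
  have TS: "T (S x) = x" if "x \<in> carr Y" for x
    using that inj by (simp add: T_def)
  have T_in: "T u \<in> carr Y" "S (T u) = u" if "u \<in> carr X" for u
    using that S by (auto simp: T_def inv_into_into f_inv_into_f)
  have "linear_map_between X Y T"
    unfolding linear_map_between_def
  proof (intro conjI ballI allI)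
    show "T ` carr X \<subseteq> carr Y" using T_in by auto
    show "T (add X u v) = add Y (T u) (T v)" if "u \<in> carr X" "v \<in> carr X" for u v
      using TS[OF Y_closed(1)] lin(1) T_in that by metis
    show "T (smult X c u) = smult Y c (T u)" if "u \<in> carr X" for c u
      using TS[OF Y_closed(2)] lin(2) T_in that by metis
  qed
  moreover have "homeomorphic_maps (norm_topology X) (norm_topology Y) T S"
    unfolding homeomorphic_maps_def norm_topology_def
  proof (intro conjI)
    show "continuous_map X.mtopology Y.mtopology T"
      using T_in lower \<open>D > 0\<close> by (intro Lipschitz_imp_continuous_map[OF X Y, of _ D]) (auto, metis)
    show "continuous_map Y.mtopology X.mtopology S"
      using S upper \<open>C > 0\<close> by (intro Lipschitz_imp_continuous_map[OF Y X, of _ C]) auto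
  qed (auto simp: TS T_in)
  ultimately show ?thesis
    by (auto simp: isomorphic_spaces_def homeomorphic_map_maps)
qed

context orlicz_interval
begin

section \<open>Primitives\<close>

text \<open>
  The cut-off sits in the integrand rather than in the domain, so that Fubini's theorem applies to the
  product of one fixed finite measure space with itself.
\<close>

definition primitive :: "(real \<Rightarrow> complex) \<Rightarrow> real \<Rightarrow> complex" where
  "primitive g t = (LINT s|M. (if s \<le> t then g s else 0))"

lemma id_measurable_M: "(\<lambda>x. x) \<in> borel_measurable M"
  by (intro measurable_restrict_space1 measurable_completion) simp

lemma integrable_imp_locally_integrable:
  assumes "integrable M g" shows "locally_integrable \<Omega> g"
  unfolding locally_integrable_def
proof (intro allI impI)
  fix K assume K: "compact K \<and> K \<subseteq> \<Omega>"
  have "set_integrable lebesgue \<Omega> g"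
    using assms by (simp add: integrable_restrict_space set_integrable_def)
  then show "g absolutely_integrable_on K"
    by (rule set_integrable_subset) (use K in \<open>auto simp: compact_imp_closed\<close>)
qed

lemma integrable_truncated:
  fixes g :: "real \<Rightarrow> complex"
  assumes "integrable M g" shows "integrable M (\<lambda>s. if s \<le> t then g s else 0)"
proof (rule Bochner_Integration.integrable_bound[OF assms])
  have [measurable]: "g \<in> borel_measurable M" "(\<lambda>x. x) \<in> borel_measurable M"
    using assms id_measurable_M by auto
  show "(\<lambda>s. if s \<le> t then g s else 0) \<in> borel_measurable M" by measurable
qed auto

lemma primitive_add:
  assumes "integrable M g" "integrable M h"
  shows "primitive (\<lambda>s. g s + h s) t = primitive g t + primitive h t"
proof -
  have "(\<lambda>s. if s \<le> t then g s + h s else 0) = (\<lambda>s. (if s \<le> t then g s else 0) + (if s \<le> t then h s else 0))"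
    by auto
  then show ?thesis
    using assms by (simp add: primitive_def integrable_truncated)
qed

lemma primitive_scale: "primitive (\<lambda>s. c * g s) t = c * primitive g t"
proof -
  have "(\<lambda>s. if s \<le> t then c * g s else 0) = (\<lambda>s. c * (if s \<le> t then g s else 0))"
    by auto
  then show ?thesis by (simp add: primitive_def)
qed

lemma norm_primitive_le:
  assumes "integrable M g" shows "norm (primitive g t) \<le> (LINT s|M. norm (g s))"
proof -
  have "norm (primitive g t) \<le> (LINT s|M. norm (if s \<le> t then g s else 0))"
    unfolding primitive_def by (rule integral_norm_bound)
  also have "\<dots> \<le> (LINT s|M. norm (g s))"
    using assms by (intro integral_mono integrable_norm integrable_truncated) auto
  finally show ?thesis .
qed

lemma truncated_measurable_pair:
  assumes "g \<in> borel_measurable M"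
  shows "(\<lambda>p. if snd p \<le> fst p then g (snd p) else 0) \<in> borel_measurable (M \<Otimes>\<^sub>M M)"
proof -
  have [measurable]: "g \<in> borel_measurable M" "fst \<in> borel_measurable (M \<Otimes>\<^sub>M M)" "snd \<in> borel_measurable (M \<Otimes>\<^sub>M M)"
    using assms measurable_compose[OF measurable_fst id_measurable_M, of M]
      measurable_compose[OF measurable_snd id_measurable_M, of M] by auto
  have [measurable]: "(\<lambda>p. g (snd p)) \<in> borel_measurable (M \<Otimes>\<^sub>M M)"
    by (rule measurable_compose[OF measurable_snd assms])
  show ?thesis by measurable
qed

lemma primitive_measurable:
  assumes "integrable M g" shows "primitive g \<in> borel_measurable M"
proof -
  interpret finite_measure M by (rule finite_measure_M)
  have "case_prod (\<lambda>t s. if s \<le> t then g s else 0) \<in> borel_measurable (M \<Otimes>\<^sub>M M)"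
    using truncated_measurable_pair[of g] assms by (simp add: split_beta')
  then have "(\<lambda>t. LINT s|M. (if s \<le> t then g s else 0)) \<in> borel_measurable M"
    by (rule borel_measurable_lebesgue_integral)
  then show ?thesis by (simp add: primitive_def[abs_def])
qed

text \<open>
  The boundary term at \<open>\<beta>\<close> vanishes because the support of \<open>\<psi>\<close> is a compact subset of the open interval.
\<close>

lemma integral_test_function_deriv:
  assumes \<psi>: "test_function \<Omega> \<psi>" and s: "s \<in> \<Omega>"
  shows "(LINT t|M. (if s \<le> t then deriv \<psi> t else 0)) = - \<psi> s"
proof -
  note \<psi>' = test_function_deriv[OF \<psi>]
  \<comment> \<open>The right end point may be added because the derivative vanishes there.\<close>
  have "(LINT t|M. (if s \<le> t then deriv \<psi> t else 0)) = (LINT t|lebesgue. deriv \<psi> t * indicator {s..\<beta>} t)"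
    using s test_function_zero[OF \<psi>', of \<beta>]
    by (subst integral_restrict_space)
      (auto simp: indicator_def intro!: Bochner_Integration.integral_cong)
  also have "\<dots> = (LINT t|lborel. deriv \<psi> t * indicator {s..\<beta>} t)"
  proof (rule integral_completion)
    have "deriv \<psi> \<in> borel_measurable borel"
      using test_function_isCont[OF \<psi>']
      by (intro borel_measurable_continuous_onI continuous_at_imp_continuous_on) auto
    then show "(\<lambda>t. deriv \<psi> t * indicator {s..\<beta>} t) \<in> borel_measurable lborel" by simp
  qed
  also have "\<dots> = \<psi> \<beta> - \<psi> s"
    using s test_function_isCont[OF \<psi>'] test_function_has_deriv[OF \<psi>]
    by (intro integral_FTC_Icc_real) auto
  finally show ?thesis using test_function_zero[OF \<psi>, of \<beta>] by simp
qed

text \<open>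
  Fubini's theorem on the triangle \<open>s \<le> t\<close> replaces integration by parts: integrating \<open>\<psi>'(t) g(s)\<close> first over
  \<open>t\<close> leaves \<open>- \<psi>(s) g(s)\<close>.
\<close>

lemma is_weak_deriv_primitive:
  assumes g: "integrable M g"
  shows "is_weak_deriv \<Omega> (primitive g) g"
  unfolding is_weak_deriv_def
proof (intro conjI allI impI)
  interpret F: finite_measure M by (rule finite_measure_M)
  interpret pair_sigma_finite M M ..
  show "locally_integrable \<Omega> g" by (rule integrable_imp_locally_integrable[OF g])
  show "locally_integrable \<Omega> (primitive g)"
    using norm_primitive_le[OF g] primitive_measurable[OF g]
    by (intro integrable_imp_locally_integrable F.integrable_const_bound[where B="LINT s|M. norm (g s)"]) auto
  fix \<psi> assume \<psi>: "test_function \<Omega> \<psi>"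
  note \<psi>' = test_function_deriv[OF \<psi>]
  obtain B where B: "\<And>x. \<bar>deriv \<psi> x\<bar> \<le> B" "B \<ge> 0"
    using test_function_bounded[OF \<psi>'] by blast
  let ?F = "\<lambda>t s. deriv \<psi> t *\<^sub>R (if s \<le> t then g s else 0)"
  have F_meas: "case_prod ?F \<in> borel_measurable (M \<Otimes>\<^sub>M M)"
  proof -
    have "(\<lambda>p. deriv \<psi> (fst p)) \<in> borel_measurable (M \<Otimes>\<^sub>M M)"
      by (rule measurable_compose[OF measurable_fst test_function_measurable[OF \<psi>']])
    then have "(\<lambda>p. deriv \<psi> (fst p) *\<^sub>R (if snd p \<le> fst p then g (snd p) else 0)) \<in> borel_measurable (M \<Otimes>\<^sub>M M)"
      using truncated_measurable_pair[of g] g by (intro borel_measurable_scaleR) auto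
    then show ?thesis by (simp add: split_beta')
  qed
  have F_slice: "integrable M (?F t)" for t
    using integrable_truncated[OF g] by simp
  have "integrable (M \<Otimes>\<^sub>M M) (case_prod ?F)"
  proof (rule Fubini_integrable[OF F_meas])
    have "norm (LINT s|M. norm (?F t s)) \<le> B * (LINT s|M. norm (g s))" for t
    proof -
      have "norm (LINT s|M. norm (?F t s)) = (LINT s|M. norm (?F t s))"
        by (simp add: integral_nonneg_AE)
      also have "\<dots> \<le> (LINT s|M. B * norm (g s))"
        using F_slice g B by (intro integral_mono integrable_norm) (auto intro!: mult_mono)
      finally show ?thesis by simp
    qed
    moreover have "(\<lambda>t. LINT s|M. norm (?F t s)) \<in> borel_measurable M"
    proof (rule F.borel_measurable_lebesgue_integral)
      have "(\<lambda>p. norm (case_prod ?F p)) \<in> borel_measurable (M \<Otimes>\<^sub>M M)"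
        using F_meas by measurable
      then show "case_prod (\<lambda>t s. norm (?F t s)) \<in> borel_measurable (M \<Otimes>\<^sub>M M)"
        by (simp add: split_beta')
    qed
    ultimately show "integrable M (\<lambda>t. LINT s|M. norm (case (t, s) of (t, s) \<Rightarrow> ?F t s))"
      by (intro F.integrable_const_bound[where B="B * (LINT s|M. norm (g s))"]) auto
    show "AE t in M. integrable M (\<lambda>s. case (t, s) of (t, s) \<Rightarrow> ?F t s)"
      using F_slice by simp
  qed
  then have "(LINT s|M. LINT t|M. ?F t s) = (LINT t|M. LINT s|M. ?F t s)"
    by (rule Fubini_integral)
  moreover have "(LINT t|M. LINT s|M. ?F t s) = (LINT t|M. deriv \<psi> t *\<^sub>R primitive g t)"
    by (simp add: primitive_def)
  moreover have "(LINT s|M. LINT t|M. ?F t s) = (LINT s|M. - (\<psi> s *\<^sub>R g s))"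
  proof (rule Bochner_Integration.integral_cong[OF refl])
    fix s assume s: "s \<in> space M"
    have "(LINT t|M. ?F t s) = (LINT t|M. (if s \<le> t then deriv \<psi> t else 0) *\<^sub>R g s)"
      by (rule Bochner_Integration.integral_cong) auto
    also have "\<dots> = (LINT t|M. (if s \<le> t then deriv \<psi> t else 0)) *\<^sub>R g s"
    proof (cases "g s = 0")
      case False
      have [measurable]: "deriv \<psi> \<in> borel_measurable M" "(\<lambda>x. x) \<in> borel_measurable M"
        using test_function_measurable[OF \<psi>'] id_measurable_M by auto
      have "integrable M (\<lambda>t. if s \<le> t then deriv \<psi> t else 0)"
        using B by (intro F.integrable_const_bound[where B=B]) auto
      then show ?thesis by simp
    qed simp
    also have "\<dots> = - (\<psi> s *\<^sub>R g s)"
      using s by (simp add: integral_test_function_deriv[OF \<psi>])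
    finally show "(LINT t|M. ?F t s) = - (\<psi> s *\<^sub>R g s)" .
  qed
  ultimately show "(LINT x|M. deriv \<psi> x *\<^sub>R primitive g x) = - (LINT x|M. \<psi> x *\<^sub>R g x)"
    by simp
qed

section \<open>Embedding the bounded sequences when \<open>\<Delta>\<^sub>2\<close> fails\<close>

text \<open>
  The failure of \<open>\<Delta>\<^sub>2\<close> is used beyond a point where \<open>\<phi>\<close> is already large, so that the sets
  of measure \<open>2 / \<phi>(2 u\<^sub>n)\<close> chosen below are small enough to fit into the interval side by side.
\<close>

lemma not_Delta2_sequence:
  assumes "\<not> Delta2_infty \<phi>"
  obtains u where "\<And>n::nat. u n > 0" "\<And>n. \<phi> (2 * u n) > 2 ^ (n + 2) * \<phi> (u n)"
    "\<And>n. \<phi> (2 * u n) \<ge> 2 ^ (n + 2) / (\<beta> - \<alpha>)"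
proof -
  have "\<exists>u>0. \<phi> (2 * u) > 2 ^ (n + 2) * \<phi> u \<and> \<phi> (2 * u) \<ge> 2 ^ (n + 2) / (\<beta> - \<alpha>)" for n :: nat
  proof -
    \<comment> \<open>Beyond v the required lower bound holds, so v is taken as the threshold in the negation of the growth condition.\<close>
    obtain v where v: "v > 0" "\<phi> v \<ge> 2 ^ (n + 2) / (\<beta> - \<alpha>)" by (rule phi_unbounded)
    have "\<exists>u\<ge>v. \<phi> (2 * u) > 2 ^ (n + 2) * \<phi> u"
    proof (rule ccontr)
      assume "\<not> ?thesis"
      then have "Delta2_infty \<phi>"
        unfolding Delta2_infty_def using v(1)
        by (intro exI[of _ "2 ^ (n + 2)"] conjI exI[of _ v]) (auto simp: not_less)
      with assms show False by simp
    qed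
    then obtain u where u: "u \<ge> v" "\<phi> (2 * u) > 2 ^ (n + 2) * \<phi> u" by blast
    have "\<phi> v \<le> \<phi> (2 * u)" using u v by (intro phi_mono) auto
    then show ?thesis using u v by (intro exI[of _ u]) auto
  qed
  then show thesis using that by metis
qed

text \<open>
  Put \<open>w = u\<^sub>n\<close> on disjoint intervals \<open>A\<^sub>n\<close> of length \<open>2 / \<phi>(2 u\<^sub>n)\<close>. The modular of \<open>w\<close> is the sum of
  \<open>2 \<phi>(u\<^sub>n) / \<phi>(2 u\<^sub>n) < 2\<^sup>-\<^sup>n\<^sup>-\<^sup>1\<close>, hence at most \<open>1\<close>, whereas doubling a single piece already gives modular
  \<open>2\<close>. So multiplying the pieces by the terms of a bounded sequence embeds \<open>\<ell>\<^sup>\<infinity>\<close> into \<open>L\<^sup>\<phi>\<close>. The multiplier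
  is the function \<open>x \<circ> idx\<close>, which is linear in \<open>x\<close> by construction.
\<close>

lemma ell_infty_copy_in_L_phi:
  assumes "\<not> Delta2_infty \<phi>"
  obtains w :: "real \<Rightarrow> real" and idx :: "real \<Rightarrow> nat" where
    "\<forall>x. (\<lambda>t. x (idx t) * complex_of_real (w t)) \<in> borel_measurable M"
    "\<forall>x l. l > 0 \<longrightarrow> (\<forall>n. cmod (x n) \<le> l) \<longrightarrow> lux (\<lambda>t. x (idx t) * complex_of_real (w t)) \<le> ennreal l"
    "\<forall>x n. ennreal (cmod (x n) / 2) \<le> lux (\<lambda>t. x (idx t) * complex_of_real (w t))"
proof -
  obtain u where u_pos: "\<And>n::nat. u n > 0" and u_big: "\<And>n. \<phi> (2 * u n) > 2 ^ (n + 2) * \<phi> (u n)"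
    and u_len: "\<And>n. \<phi> (2 * u n) \<ge> 2 ^ (n + 2) / (\<beta> - \<alpha>)"
    using not_Delta2_sequence[OF assms] by metis
  have pos: "\<phi> (2 * u n) > 0" for n
  proof -
    have "0 \<le> 2 ^ (n + 2) * \<phi> (u n)" using u_pos[of n] by (intro mult_nonneg_nonneg phi_nonneg) auto
    then show ?thesis using u_big[of n] by linarith
  qed
  define L where "L = \<beta> - \<alpha>"
  \<comment> \<open>The pieces are placed in the dyadic intervals from a n to 2 a n to the right of the left end point.\<close>
  define a where "a n = L / 2 ^ (n + 1)" for n :: nat
  define A where "A n = {\<alpha> + a n<..<\<alpha> + a n + 2 / \<phi> (2 * u n)}" for n
  have L: "L > 0" using interval by (simp add: L_def)
  have len: "2 / \<phi> (2 * u n) \<le> a n" for n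
    using u_len[of n] pos[of n] L by (simp add: a_def L_def field_simps)
  have a_pos: "a n > 0" for n using L by (simp add: a_def)
  have A_sub: "A n \<subseteq> {\<alpha> + a n<..<\<alpha> + 2 * a n}" for n
    using len[of n] by (auto simp: A_def)
  have a_le: "2 * a m \<le> a n" if "n < m" for n m
  proof -
    have "(2::real) ^ (n + 1) \<le> 2 ^ m" using that by (intro power_increasing) auto
    then show ?thesis using L by (simp add: a_def field_simps)
  qed
  have disj: "m = n" if "t \<in> A n" "t \<in> A m" for t m n
  proof (rule ccontr)
    assume "m \<noteq> n"
    then consider "m < n" | "n < m" by linarith
    then show False
      by cases (use a_le[of m n] a_le[of n m] subsetD[OF A_sub that(1)] subsetD[OF A_sub that(2)] in auto)
  qed
  have A_\<Omega>: "A n \<subseteq> \<Omega>" for n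
  proof -
    have "2 * a n \<le> L" using L by (simp add: a_def field_simps)
    then show ?thesis using A_sub[of n] a_pos[of n] by (auto simp: L_def subset_eq)
  qed
  have A_meas: "A n \<in> sets M" for n
    using A_\<Omega>[of n] by (simp add: sets_restrict_space_iff A_def)
  have A_emeasure: "emeasure M (A n) = ennreal (2 / \<phi> (2 * u n))" for n
    using A_\<Omega>[of n] pos[of n] by (simp add: emeasure_restrict_space) (simp add: A_def)
  define idx where "idx t = (LEAST n. t \<in> A n)" for t
  define w where "w t = (if \<exists>n. t \<in> A n then u (idx t) else 0)" for t
  have idx: "idx t = n" if "t \<in> A n" for t n
    unfolding idx_def using that disj by (intro Least_equality) auto
  have w_A: "w t = u n" if "t \<in> A n" for t n
    using that idx[OF that] by (auto simp: w_def)
  have pred: "Measurable.pred M (\<lambda>t. t \<in> A n)" for n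
  proof -
    have "{t \<in> space M. t \<in> A n} = A n" using A_\<Omega>[of n] by auto
    then show ?thesis using A_meas[of n] by (simp only: pred_def)
  qed
  have idx_meas: "idx \<in> measurable M (count_space UNIV)"
    unfolding idx_def[abs_def] using pred by (rule measurable_Least)
  have w_meas: "w \<in> borel_measurable M"
  proof -
    have "Measurable.pred M (\<lambda>t. \<exists>n. t \<in> A n)" using pred by measurable
    moreover have "(\<lambda>t. u (idx t)) \<in> borel_measurable M"
      by (rule measurable_compose[OF idx_meas]) simp
    ultimately show ?thesis unfolding w_def[abs_def] by measurable
  qed
  define g where "g x t = x (idx t) * complex_of_real (w t)" for x t
  have g_meas: "g x \<in> borel_measurable M" for x
  proof -
    have "(\<lambda>t. x (idx t)) \<in> borel_measurable M"
      by (rule measurable_compose[OF idx_meas]) simp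
    then show ?thesis using w_meas unfolding g_def[abs_def] by measurable
  qed
  have upper: "lux (g x) \<le> ennreal l" if l: "l > 0" "\<And>n. cmod (x n) \<le> l" for x l
  proof (rule lux_le[OF l(1)])
    have "modular (\<lambda>t. g x t / of_real l) \<le> (\<integral>\<^sup>+t. (\<Sum>n. ennreal (\<phi> (u n)) * indicator (A n) t) \<partial>M)"
      unfolding orlicz_modular_def
    proof (rule nn_integral_mono)
      fix t
      show "ennreal (\<phi> (cmod (g x t / of_real l))) \<le> (\<Sum>n. ennreal (\<phi> (u n)) * indicator (A n) t)"
      proof (cases "\<exists>n. t \<in> A n")
        case True
        then obtain n where n: "t \<in> A n" by blast
        have "cmod (g x t / of_real l) = cmod (x n) / l * u n"
          using l(1) u_pos[of n] by (simp add: g_def idx[OF n] w_A[OF n] norm_mult norm_divide)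
        also have "\<dots> \<le> 1 * u n"
          using l u_pos[of n] by (intro mult_right_mono) auto
        finally have "ennreal (\<phi> (cmod (g x t / of_real l))) \<le> (\<Sum>k\<in>{n}. ennreal (\<phi> (u k)) * indicator (A k) t)"
          using n by (auto intro!: ennreal_leI phi_mono)
        also have "\<dots> \<le> (\<Sum>n. ennreal (\<phi> (u n)) * indicator (A n) t)"
          by (intro sum_le_suminf) auto
        finally show ?thesis .
      qed (simp add: g_def w_def phi_0)
    qed
    also have "\<dots> = (\<Sum>n. ennreal (\<phi> (u n)) * emeasure M (A n))"
      using A_meas by (subst nn_integral_suminf) (auto simp: nn_integral_cmult_indicator)
    also have "\<dots> \<le> (\<Sum>n. ennreal ((1 / 2) ^ Suc n))"
    proof (intro suminf_le)
      fix n
      have "\<phi> (u n) * (2 / \<phi> (2 * u n)) \<le> (1 / 2) ^ Suc n"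
        using u_big[of n] pos[of n] by (simp add: field_simps)
      then show "ennreal (\<phi> (u n)) * emeasure M (A n) \<le> ennreal ((1 / 2) ^ Suc n)"
        using u_pos[of n] pos[of n] phi_nonneg[of "u n"]
        by (simp add: A_emeasure ennreal_leI flip: ennreal_mult)
    qed auto
    also have "\<dots> = 1"
    proof -
      have "(\<Sum>n. ennreal ((1 / 2) ^ Suc n)) = ennreal 1"
        by (rule suminf_ennreal_eq[OF _ power_half_series]) simp
      then show ?thesis by simp
    qed
    finally show "modular (\<lambda>t. g x t / of_real l) \<le> 1" .
  qed
  have lower: "ennreal (cmod (x n) / 2) \<le> lux (g x)" for x n
  proof (rule ccontr)
    assume "\<not> ?thesis"
    then have "lux (g x) < ennreal (cmod (x n) / 2)" by simp
    note l = lux_lessD[OF this]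
    have "2 = (\<integral>\<^sup>+t. ennreal (\<phi> (2 * u n)) * indicator (A n) t \<partial>M)"
      using A_meas pos[of n] by (simp add: nn_integral_cmult_indicator A_emeasure flip: ennreal_mult)
    also have "\<dots> \<le> modular (\<lambda>t. g x t / of_real (cmod (x n) / 2))"
      unfolding orlicz_modular_def
    proof (rule nn_integral_mono)
      fix t
      have "cmod (g x t / of_real (cmod (x n) / 2)) = 2 * u n" if t: "t \<in> A n"
        using l(1) u_pos[of n] by (simp add: g_def idx[OF t] w_A[OF t] norm_mult norm_divide)
      then show "ennreal (\<phi> (2 * u n)) * indicator (A n) t \<le> ennreal (\<phi> (cmod (g x t / of_real (cmod (x n) / 2))))"
        by (auto simp: indicator_def)
    qed
    also have "\<dots> \<le> 1" by (rule l(2))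
    finally show False by simp
  qed
  show thesis
    by (rule that[of idx w]) (use g_meas upper lower in \<open>simp_all add: g_def[abs_def]\<close>)
qed

text \<open>
  Taking primitives is bounded from \<open>L\<^sup>\<phi>\<close> to \<open>W\<^sup>1\<^sup>,\<^sup>\<phi>\<close>: the primitive is bounded by the \<open>L\<^sup>1\<close> norm, which the
  Luxemburg norm controls, and on a bounded interval the Luxemburg norm is controlled by the supremum.
\<close>

lemma snorm_primitive_le:
  obtains C where "C > 0"
    "\<And>g l. g \<in> borel_measurable M \<Longrightarrow> l > 0 \<Longrightarrow> lux g \<le> ennreal l \<Longrightarrow>
       integrable M g \<and> snorm (primitive g) \<le> ennreal (C * l)"
proof -
  obtain K where K: "K > 0"
    "\<And>f l. f \<in> borel_measurable M \<Longrightarrow> lux f < ennreal l \<Longrightarrow> (\<integral>\<^sup>+x. norm (f x) \<partial>M) \<le> ennreal (K * l)"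
    using L1_le_lux by blast
  obtain c where c: "c > 0" "\<phi> c \<le> 1 / (\<beta> - \<alpha>)"
    using phi_small[of "1 / (\<beta> - \<alpha>)"] interval by auto
  let ?C = "2 * K / c + 1"
  show thesis
  proof (rule that[of ?C])
    show "?C > 0" using K(1) c(1) by (intro add_pos_pos) auto
    fix g l assume g: "g \<in> borel_measurable M" and l: "l > 0" "lux g \<le> ennreal l"
    \<comment> \<open>The bound for the integral requires a strict inequality for the Luxemburg norm, hence the factor two.\<close>
    have "ennreal l < ennreal (2 * l)" using l(1) by (simp add: ennreal_less_iff)
    then have nn: "(\<integral>\<^sup>+x. norm (g x) \<partial>M) \<le> ennreal (K * (2 * l))"
      using l(2) by (intro K(2)[OF g]) auto
    then have int: "integrable M g"
      using g by (intro integrableI_bounded) (auto intro: le_less_trans)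
    have "ennreal (LINT s|M. norm (g s)) \<le> ennreal (K * (2 * l))"
      using nn int by (subst nn_integral_eq_integral[symmetric]) auto
    then have "(LINT s|M. norm (g s)) \<le> 2 * K * l"
      using K(1) l(1) by (simp add: ennreal_le_iff)
    then have prim: "cmod (primitive g t) \<le> 2 * K * l" for t
      using norm_primitive_le[OF int, of t] by linarith
    have kpos: "2 * K / c * l > 0" using K(1) c(1) l(1) by simp
    have "modular (\<lambda>t. primitive g t / of_real (2 * K / c * l)) \<le> (\<integral>\<^sup>+t. ennreal (\<phi> c) \<partial>M)"
      unfolding orlicz_modular_def
    proof (intro nn_integral_mono ennreal_leI phi_mono)
      fix t
      have "cmod (primitive g t / of_real (2 * K / c * l)) = cmod (primitive g t) / (2 * K / c * l)"
        using kpos by (simp only: norm_divide norm_of_real abs_of_pos)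
      also have "\<dots> \<le> c" using prim[of t] K(1) c(1) l(1) by (simp add: field_simps)
      finally show "cmod (primitive g t / of_real (2 * K / c * l)) \<le> c" .
    qed simp
    also have "\<dots> = ennreal (\<phi> c * (\<beta> - \<alpha>))"
      using interval c(1) phi_nonneg[of c] emeasure_M by (simp add: ennreal_mult)
    also have "\<dots> \<le> ennreal 1"
      using c(2) interval by (intro ennreal_leI) (simp add: field_simps)
    finally have "lux (primitive g) \<le> ennreal (2 * K / c * l)"
      using kpos by (intro lux_le) auto
    then have "snorm (primitive g) \<le> ennreal (2 * K / c * l) + ennreal l"
      unfolding sobolev_norm_eq[OF is_weak_deriv_primitive[OF int]] using l(2) by (intro add_mono)
    also have "\<dots> = ennreal (?C * l)"
      using kpos l(1) by (simp add: distrib_right flip: ennreal_plus)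
    finally show "integrable M g \<and> snorm (primitive g) \<le> ennreal (?C * l)"
      using int by blast
  qed
qed

text \<open>
  The copy of \<open>\<ell>\<^sup>\<infinity>\<close> in \<open>L\<^sup>\<phi>\<close> is lifted by taking primitives: the derivative alone gives the lower bound
  for the Sobolev norm.
\<close>

lemma contains_ell_infty:
  assumes "\<not> Delta2_infty \<phi>"
  shows "contains_subspace_isomorphic_to X ell_infty"
proof -
  obtain w :: "real \<Rightarrow> real" and idx :: "real \<Rightarrow> nat" where
    meas: "\<forall>x. (\<lambda>t. x (idx t) * complex_of_real (w t)) \<in> borel_measurable M" and
    up: "\<forall>x l. l > 0 \<longrightarrow> (\<forall>n. cmod (x n) \<le> l) \<longrightarrow> lux (\<lambda>t. x (idx t) * complex_of_real (w t)) \<le> ennreal l" and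
    low: "\<forall>x n. ennreal (cmod (x n) / 2) \<le> lux (\<lambda>t. x (idx t) * complex_of_real (w t))"
    by (rule ell_infty_copy_in_L_phi[OF assms])
  define g where "g x t = x (idx t) * complex_of_real (w t)" for x t
  define F where "F x = primitive (g x)" for x
  define S where "S x = cls (F x)" for x
  define V where "V = S ` carr ell_infty"
  obtain C where C: "C > 0" "\<And>g l. g \<in> borel_measurable M \<Longrightarrow> l > 0 \<Longrightarrow> lux g \<le> ennreal l \<Longrightarrow>
       integrable M g \<and> snorm (primitive g) \<le> ennreal (C * l)"
    using snorm_primitive_le by blast
  have bounded_le: "integrable M (g x) \<and> snorm (F x) \<le> ennreal (C * l)"
    if "l > 0" "\<And>n. cmod (x n) \<le> l" for x l
    unfolding F_def using that meas up by (intro C(2)) (simp_all add: g_def[abs_def])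
  have ex_bound: "\<exists>l>0. \<forall>n. cmod (x n) \<le> l" if x: "x \<in> carr ell_infty" for x
  proof -
    obtain B where "B > 0" "\<forall>y\<in>range x. norm y \<le> B"
      using x by (auto simp: ell_infty_simps bounded_pos)
    then show ?thesis by auto
  qed
  have int: "integrable M (g x)" if "x \<in> carr ell_infty" for x
    using ex_bound[OF that] bounded_le by blast
  have F_sob: "F x \<in> sob" if x: "x \<in> carr ell_infty" for x
  proof -
    obtain l where "l > 0" "\<And>n. cmod (x n) \<le> l" using ex_bound[OF x] by blast
    then have "snorm (F x) \<le> ennreal (C * l)" using bounded_le by blast
    then have "snorm (F x) < \<infinity>" by (auto intro: le_less_trans)
    then show ?thesis
      unfolding F_def using sobolev_norm_eq[OF is_weak_deriv_primitive[OF int[OF x]]]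
      by (intro sobolev_functionsI[OF is_weak_deriv_primitive[OF int[OF x]]]) simp
  qed
  have F_lincomb: "F (\<lambda>n. x n + c * y n) = (\<lambda>t. F x t + c * F y t)"
    if "x \<in> carr ell_infty" "y \<in> carr ell_infty" for x y c
  proof
    fix t
    have "g (\<lambda>n. x n + c * y n) = (\<lambda>s. g x s + c * g y s)"
      by (auto simp: g_def algebra_simps)
    then show "F (\<lambda>n. x n + c * y n) t = F x t + c * F y t"
      using primitive_add[of "g x" "\<lambda>s. c * g y s" t] int that by (simp add: F_def primitive_scale)
  qed
  have F_scale: "F (\<lambda>n. c * x n) = (\<lambda>t. c * F x t)" for x c
  proof
    fix t
    have "g (\<lambda>n. c * x n) = (\<lambda>s. c * g x s)" by (auto simp: g_def)
    then show "F (\<lambda>n. c * x n) t = c * F x t" by (simp add: F_def primitive_scale)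
  qed
  have V: "V \<subseteq> carr X" using F_sob by (auto simp: V_def S_def carr_X)
  have ell_scale: "(\<lambda>n. c * x n) \<in> carr ell_infty" if "x \<in> carr ell_infty" for c x
    using ell_infty_lincomb[OF that that, of "c - 1"] by (simp add: algebra_simps)
  have ell_add: "(\<lambda>n. x n + y n) \<in> carr ell_infty" if "x \<in> carr ell_infty" "y \<in> carr ell_infty" for x y
    using ell_infty_lincomb[OF that, of 1] by simp
  have S_add: "S (\<lambda>n. x n + y n) = add X (S x) (S y)" if "x \<in> carr ell_infty" "y \<in> carr ell_infty" for x y
    using F_lincomb[OF that, of 1] F_sob that by (simp add: S_def add_cls)
  have S_smult: "S (\<lambda>n. c * x n) = smult X c (S x)" if "x \<in> carr ell_infty" for x c
    using F_scale[of c x] F_sob that by (simp add: S_def smult_cls)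
  have "linear_subspace V X"
    unfolding linear_subspace_def
  proof (intro conjI ballI allI)
    have "(\<lambda>n. 0) \<in> carr ell_infty" by (auto simp: ell_infty_simps)
    then show "V \<noteq> {}" by (auto simp: V_def)
    fix u assume "u \<in> V"
    then obtain x where x: "x \<in> carr ell_infty" "u = S x" by (auto simp: V_def)
    show "smult X c u \<in> V" for c
      using S_smult[OF x(1), of c] ell_scale[OF x(1), of c] x(2) unfolding V_def by (metis imageI)
    fix v assume "v \<in> V"
    then obtain y where y: "y \<in> carr ell_infty" "v = S y" by (auto simp: V_def)
    show "add X u v \<in> V"
      using S_add[OF x(1) y(1)] ell_add[OF x(1) y(1)] x(2) y(2) unfolding V_def by (metis imageI)
  qed (rule V)
  moreover have "isomorphic_spaces (X\<lparr>carr := V\<rparr>) ell_infty"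
  proof (rule isomorphic_spacesI_bilipschitz[where S=S and C=C and D=2])
    show "Metric_space (carr (X\<lparr>carr := V\<rparr>)) (norm_dist (X\<lparr>carr := V\<rparr>))"
      using Metric_space_subset[OF V] by simp
    show "Metric_space (carr ell_infty) (norm_dist ell_infty)" by (rule Metric_space_ell_infty)
    fix x y assume xy: "x \<in> carr ell_infty" "y \<in> carr ell_infty"
    have in_V: "cls (F x) \<in> V" "cls (F y) \<in> V" using xy by (auto simp: V_def S_def)
    have dF: "F (\<lambda>n. x n - y n) = (\<lambda>t. F x t - F y t)"
      using F_lincomb[OF xy, of "-1"] by simp
    have d: "norm_dist (X\<lparr>carr := V\<rparr>) (S x) (S y) = enn2real (snorm (F (\<lambda>n. x n - y n)))"
      using norm_dist_cls[OF V F_sob[OF xy(1)] in_V(1) F_sob[OF xy(2)] in_V(2)]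
      unfolding S_def dF .
    have xy_in: "(\<lambda>n. x n - y n) \<in> carr ell_infty"
      using ell_infty_lincomb[OF xy, of "-1"] by simp
    show "norm_dist (X\<lparr>carr := V\<rparr>) (S x) (S y) \<le> C * norm_dist ell_infty x y"
    proof (rule field_le_epsilon)
      fix e :: real assume e: "e > 0"
      let ?l = "norm_dist ell_infty x y + e / C"
      have eC: "e / C > 0" using e C(1) by simp
      have l: "cmod (x n - y n) \<le> ?l" for n
        using ell_infty_dist_ge[OF xy, of n] eC by linarith
      have "norm_dist ell_infty x y \<ge> 0"
        by (rule order_trans[OF norm_ge_zero ell_infty_dist_ge[OF xy, of 0]])
      then have lpos: "?l > 0" using eC by linarith
      have "snorm (F (\<lambda>n. x n - y n)) \<le> ennreal (C * ?l)"
        using bounded_le[OF lpos, of "\<lambda>n. x n - y n"] l by blast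
      then have "enn2real (snorm (F (\<lambda>n. x n - y n))) \<le> C * ?l"
        using C(1) lpos by (intro enn2real_leI) auto
      also have "C * ?l = C * norm_dist ell_infty x y + e"
        using C(1) by (simp add: field_simps)
      finally show "norm_dist (X\<lparr>carr := V\<rparr>) (S x) (S y) \<le> C * norm_dist ell_infty x y + e"
        unfolding d .
    qed
    show "norm_dist ell_infty x y \<le> 2 * norm_dist (X\<lparr>carr := V\<rparr>) (S x) (S y)"
    proof (rule ell_infty_dist_le[OF xy])
      fix n
      have "ennreal (cmod (x n - y n) / 2) \<le> lux (g (\<lambda>n. x n - y n))"
        using low[rule_format, of "\<lambda>n. x n - y n" n] by (simp add: g_def[abs_def])
      also have "\<dots> \<le> snorm (F (\<lambda>n. x n - y n))"
        unfolding F_def sobolev_norm_eq[OF is_weak_deriv_primitive[OF int[OF xy_in]]] by simp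
      finally have "enn2real (ennreal (cmod (x n - y n) / 2)) \<le> enn2real (snorm (F (\<lambda>n. x n - y n)))"
        using sobolev_functionsD(4)[OF F_sob[OF xy_in]] by (intro enn2real_mono) auto
      then show "cmod (x n - y n) \<le> 2 * norm_dist (X\<lparr>carr := V\<rparr>) (S x) (S y)"
        unfolding d by simp
    qed
  qed (use C(1) in \<open>auto simp: V_def ell_infty_simps(2,3) S_add S_smult ell_add ell_scale\<close>)
  ultimately show ?thesis
    by (auto simp: contains_subspace_isomorphic_to_def)
qed

section \<open>Separability under \<open>\<Delta>\<^sub>2\<close>\<close>

text \<open>
  Under \<open>\<Delta>\<^sub>2\<close> the modular of \<open>2h\<close> is at most \<open>k\<close> times that of \<open>h\<close> plus a constant that covers the values
  below \<open>u\<^sub>0\<close> and is integrable because the interval is bounded; iterate.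
\<close>

lemma modular_scale_finite:
  assumes D: "Delta2_infty \<phi>" and f [measurable]: "f \<in> borel_measurable M" and fin: "lux f < \<infinity>"
  shows "modular (\<lambda>x. of_real c * f x) < \<infinity>"
proof -
  obtain k u0 where k: "k > 0" "u0 \<ge> 0" "\<And>u. u \<ge> u0 \<Longrightarrow> \<phi> (2 * u) \<le> k * \<phi> u"
    using D by (auto simp: Delta2_infty_def)
  have double: "modular (\<lambda>x. 2 * h x) < \<infinity>" if h: "h \<in> borel_measurable M" "modular h < \<infinity>" for h
  proof -
    have [measurable]: "(\<lambda>x. \<phi> (cmod (h x))) \<in> borel_measurable M"
      by (rule phi_measurable[OF h(1)])
    have "modular (\<lambda>x. 2 * h x) \<le> (\<integral>\<^sup>+x. ennreal k * ennreal (\<phi> (cmod (h x))) + ennreal (\<phi> (2 * u0)) \<partial>M)"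
      unfolding orlicz_modular_def
    proof (rule nn_integral_mono)
      fix x
      have "\<phi> (2 * cmod (h x)) \<le> k * \<phi> (cmod (h x)) + \<phi> (2 * u0)"
      proof (cases "cmod (h x) \<ge> u0")
        case True
        then show ?thesis using k(3)[OF True] phi_nonneg[of "2 * u0"] k(2) by simp
      next
        case False
        then have "\<phi> (2 * cmod (h x)) \<le> \<phi> (2 * u0)" by (intro phi_mono) auto
        moreover have "0 \<le> k * \<phi> (cmod (h x))" using k(1) phi_nonneg[of "cmod (h x)"] by simp
        ultimately show ?thesis by linarith
      qed
      then have "ennreal (\<phi> (cmod (2 * h x))) \<le> ennreal (k * \<phi> (cmod (h x)) + \<phi> (2 * u0))"
        by (intro ennreal_leI) (simp add: norm_mult)
      also have "\<dots> = ennreal k * ennreal (\<phi> (cmod (h x))) + ennreal (\<phi> (2 * u0))"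
        using k(1,2) phi_nonneg by (simp add: ennreal_mult)
      finally show "ennreal (\<phi> (cmod (2 * h x))) \<le> ennreal k * ennreal (\<phi> (cmod (h x))) + ennreal (\<phi> (2 * u0))" .
    qed
    also have "\<dots> = ennreal k * modular h + ennreal (\<phi> (2 * u0)) * ennreal (\<beta> - \<alpha>)"
      using emeasure_M by (simp add: nn_integral_add nn_integral_cmult orlicz_modular_def)
    also have "\<dots> < \<infinity>"
      using h(2) by (simp add: ennreal_mult_less_top)
    finally show ?thesis .
  qed
  obtain r where r: "r \<ge> 0" "lux f = ennreal r"
    using fin by (cases "lux f") auto
  then have "lux f < ennreal (r + 1)"
    by (simp add: ennreal_less_iff)
  note l = lux_lessD[OF this]
  have pow: "modular (\<lambda>x. 2 ^ m * (f x / of_real (r + 1))) < \<infinity>" for m :: nat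
  proof (induction m)
    case 0
    then show ?case using l(2) by (simp add: le_less_trans)
  next
    case (Suc m)
    then have "modular (\<lambda>x. 2 * (2 ^ m * (f x / of_real (r + 1)))) < \<infinity>"
      by (intro double) auto
    then show ?case by (simp add: mult.assoc)
  qed
  obtain m :: nat where "\<bar>c\<bar> * (r + 1) < 2 ^ m"
    using real_arch_pow[of 2 "\<bar>c\<bar> * (r + 1)"] by auto
  then have m: "\<bar>c\<bar> \<le> 2 ^ m / (r + 1)"
    using l(1) by (simp add: field_simps)
  have "modular (\<lambda>x. of_real c * f x) \<le> modular (\<lambda>x. 2 ^ m * (f x / of_real (r + 1)))"
  proof (intro modular_mono AE_I2)
    fix x
    have "cmod (of_real c * f x) = \<bar>c\<bar> * cmod (f x)" by (simp add: norm_mult)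
    also have "\<dots> \<le> 2 ^ m / (r + 1) * cmod (f x)" using m by (intro mult_right_mono) auto
    also have "\<dots> = cmod (2 ^ m * (f x / of_real (r + 1)))"
      using l(1) by (simp add: norm_mult norm_divide norm_power del: of_real_add)
    finally show "cmod (of_real c * f x) \<le> cmod (2 ^ m * (f x / of_real (r + 1)))" .
  qed
  then show ?thesis using pow[of m] by (rule le_less_trans)
qed

lemma phi_tendsto_0:
  assumes "h \<longlonglongrightarrow> (0::complex)"
  shows "(\<lambda>n. ennreal (\<phi> (cmod (h n)))) \<longlonglongrightarrow> 0"
proof -
  have "(\<lambda>n. \<phi> (cmod (h n))) \<longlonglongrightarrow> 0"
  proof (rule tendstoI)
    fix e :: real assume e: "e > 0"
    obtain c where c: "c > 0" "\<phi> c \<le> e / 2" using phi_small[of "e / 2"] e by auto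
    have "eventually (\<lambda>n. cmod (h n) < c) sequentially"
      using tendstoD[OF assms c(1)] by simp
    then show "eventually (\<lambda>n. dist (\<phi> (cmod (h n))) 0 < e) sequentially"
    proof eventually_elim
      case (elim n)
      have "\<phi> (cmod (h n)) \<le> \<phi> c" using elim by (intro phi_mono) auto
      moreover have "\<phi> (cmod (h n)) \<ge> 0" by (intro phi_nonneg) auto
      ultimately show ?case using c(2) e by simp
    qed
  qed
  then show ?thesis using tendsto_ennrealI by fastforce
qed

text \<open>
  Finiteness of the modular of every multiple of \<open>H\<close> is exactly what provides an integrable majorant
  for \<open>\<phi>(h\<^sub>n / e)\<close>, for an arbitrarily small \<open>e\<close>.
\<close>

lemma lux_dominated_convergence:
  assumes h: "\<And>n. h n \<in> borel_measurable M" and H: "H \<in> borel_measurable M"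
    and lim: "AE x in M. (\<lambda>n. h n x) \<longlonglongrightarrow> 0"
    and dom: "\<And>n. AE x in M. cmod (h n x) \<le> cmod (H x)"
    and fin: "\<And>c. modular (\<lambda>x. of_real c * H x) < \<infinity>" and e: "e > 0"
  shows "\<exists>n. lux (h n) \<le> ennreal e"
proof -
  have "(\<lambda>n. modular (\<lambda>x. h n x / of_real e)) \<longlonglongrightarrow> (\<integral>\<^sup>+x. 0 \<partial>M)"
    unfolding orlicz_modular_def
  proof (rule nn_integral_dominated_convergence)
    show "(\<lambda>x. ennreal (\<phi> (cmod (h n x / of_real e)))) \<in> borel_measurable M" for n
      using h by (intro measurable_compose[OF phi_measurable measurable_ennreal]) auto
    show "(\<lambda>x. ennreal (\<phi> (cmod (of_real (1 / e) * H x)))) \<in> borel_measurable M"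
      using H by (intro measurable_compose[OF phi_measurable measurable_ennreal]) auto
    show "(\<integral>\<^sup>+x. ennreal (\<phi> (cmod (of_real (1 / e) * H x))) \<partial>M) < \<infinity>"
      using fin[of "1 / e"] by (simp add: orlicz_modular_def)
    show "AE x in M. ennreal (\<phi> (cmod (h n x / of_real e))) \<le> ennreal (\<phi> (cmod (of_real (1 / e) * H x)))" for n
      using dom[of n]
    proof eventually_elim
      case (elim x)
      then show ?case using e
        by (intro ennreal_leI phi_mono) (auto simp: norm_divide norm_mult divide_right_mono)
    qed
    show "AE x in M. (\<lambda>n. ennreal (\<phi> (cmod (h n x / of_real e)))) \<longlonglongrightarrow> 0"
      using lim
    proof eventually_elim
      case (elim x)
      have "(\<lambda>n. h n x / of_real e) \<longlonglongrightarrow> 0 / of_real e"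
        using e by (intro tendsto_divide elim tendsto_const) auto
      then show ?case by (intro phi_tendsto_0) simp
    qed
  qed simp
  then have "(\<lambda>n. modular (\<lambda>x. h n x / of_real e)) \<longlonglongrightarrow> 0" by simp
  then have "eventually (\<lambda>n. modular (\<lambda>x. h n x / of_real e) < 1) sequentially"
    by (rule order_tendstoD) simp
  then obtain n where "modular (\<lambda>x. h n x / of_real e) < 1"
    by (auto simp: eventually_sequentially)
  then show ?thesis using e by (intro exI[of _ n] lux_le) auto
qed

text \<open>
  The values are stored in a list, so that countably many values give countably many step functions.
\<close>

definition step_fun :: "nat \<Rightarrow> complex list \<Rightarrow> real \<Rightarrow> complex" where
  "step_fun k qs x = (let i = nat \<lfloor>real k * (x - \<alpha>)\<rfloor> in if i < length qs then qs ! i else 0)"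

lemma step_fun_measurable: "step_fun k qs \<in> borel_measurable M"
proof -
  have "(\<lambda>x. real k * (x - \<alpha>)) \<in> borel_measurable M"
    using id_measurable_M by measurable
  then have "(\<lambda>x. \<lfloor>real k * (x - \<alpha>)\<rfloor>) \<in> measurable M (count_space UNIV)"
    by measurable
  from measurable_compose[OF this, of "\<lambda>j. if nat j < length qs then qs ! nat j else 0" borel]
  show ?thesis by (simp add: step_fun_def[abs_def] Let_def)
qed

lemma step_fun_map: "F 0 = 0 \<Longrightarrow> step_fun k (map F qs) x = F (step_fun k qs x)"
  by (simp add: step_fun_def Let_def)

lemma continuous_step_approx:
  assumes g: "continuous_on UNIV (g :: real \<Rightarrow> complex)" and "e > 0"
    and dense: "\<And>U. open U \<Longrightarrow> U \<noteq> {} \<Longrightarrow> \<exists>q\<in>Q. q \<in> U"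
  shows "\<exists>k. \<exists>qs\<in>lists Q. \<forall>x\<in>\<Omega>. cmod (g x - step_fun k qs x) < e"
proof -
  have "uniformly_continuous_on {\<alpha>..\<beta>} g"
    using g by (intro compact_uniformly_continuous continuous_on_subset[OF g]) auto
  then obtain d where d: "d > 0" "\<And>x y. x \<in> {\<alpha>..\<beta>} \<Longrightarrow> y \<in> {\<alpha>..\<beta>} \<Longrightarrow> dist x y < d \<Longrightarrow> dist (g x) (g y) < e / 2"
    using \<open>e > 0\<close> unfolding uniformly_continuous_on_def by (metis half_gt_zero dist_commute)
  obtain k :: nat where k: "k > 0" "1 / real k < d"
    using nat_approx_posE[OF d(1)] by (metis zero_less_Suc)
  have "\<exists>q\<in>Q. dist (g y) q < e / 2" for y
    using dense[of "ball (g y) (e / 2)"] \<open>e > 0\<close> by auto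
  then obtain q where q: "\<And>y. q y \<in> Q" "\<And>y. dist (g y) (q y) < e / 2" by metis
  define qs where "qs = map (\<lambda>i. q (\<alpha> + real i / real k)) [0..<Suc (nat \<lfloor>real k * (\<beta> - \<alpha>)\<rfloor>)]"
  have "cmod (g x - step_fun k qs x) < e" if x: "x \<in> \<Omega>" for x
  proof -
    define i where "i = nat \<lfloor>real k * (x - \<alpha>)\<rfloor>"
    define y where "y = \<alpha> + real i / real k"
    have "0 \<le> real k * (x - \<alpha>)" using x by auto
    then have i: "real i \<le> real k * (x - \<alpha>)" "real k * (x - \<alpha>) < real i + 1"
      unfolding i_def by linarith+
    have "real k * (x - \<alpha>) \<le> real k * (\<beta> - \<alpha>)" using x by (intro mult_left_mono) auto
    then have "i \<le> nat \<lfloor>real k * (\<beta> - \<alpha>)\<rfloor>"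
      unfolding i_def by (intro nat_mono floor_mono)
    then have step: "step_fun k qs x = q y"
      unfolding step_fun_def Let_def i_def[symmetric] qs_def y_def
      by (simp del: upt_Suc add: nth_append less_Suc_eq_le)
    have diff: "x - y = (real k * (x - \<alpha>) - real i) / real k"
      using k(1) by (simp add: y_def field_simps)
    have "0 \<le> x - y" "x - y < 1 / real k"
      unfolding diff using i k(1) by (auto intro!: divide_strict_right_mono)
    then have y: "y \<le> x" "x - y < 1 / real k" "\<alpha> \<le> y"
      by (auto simp: y_def)
    have "dist (g x) (g y) < e / 2"
      using x y k(2) by (intro d(2)) (auto simp: dist_real_def)
    then have "dist (g x) (q y) < e"
      using dist_triangle_half_l[of "g x" "g y" e "q y"] q(2)[of y]
      by (metis dist_commute dist_triangle_half_r)
    then show ?thesis by (simp add: step dist_norm)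
  qed
  moreover have "qs \<in> lists Q" using q(1) by (auto simp: qs_def)
  ultimately show ?thesis by blast
qed

text \<open>
  The dense set consists of the step functions with values in a countable dense set of complex numbers. A
  function is first truncated; a bounded function is almost everywhere a limit of continuous functions,
  and these are uniform limits of step functions. Both approximations converge in norm by dominated convergence.
\<close>

lemma Delta2_separable:
  assumes D2: "Delta2_infty \<phi>"
  obtains D where "countable D" "D \<subseteq> borel_measurable M"
    "\<forall>f e. f \<in> borel_measurable M \<longrightarrow> lux f < \<infinity> \<longrightarrow> e > 0 \<longrightarrow> (\<exists>p\<in>D. lux (\<lambda>x. f x - p x) \<le> ennreal e)"
proof -
  obtain Q :: "complex set" where Q: "countable Q" "\<And>U. open U \<Longrightarrow> U \<noteq> {} \<Longrightarrow> \<exists>q\<in>Q. q \<in> U"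
    using countable_dense_setE by blast
  define D where "D = (\<lambda>(k, qs). step_fun k qs) ` (UNIV \<times> lists (insert 0 Q))"
  have bounded_approx: "\<exists>p\<in>D. lux (\<lambda>x. f x - p x) \<le> ennreal e"
    if f: "f \<in> borel_measurable M" and m: "m > 0" "\<And>x. cmod (f x) \<le> m" and e: "e > 0" for f m e
  proof -
    have "(\<lambda>x. if x \<in> \<Omega> then f x else 0) \<in> borel_measurable lebesgue"
      using f by (intro borel_measurable_if_I) auto
    then have "(\<lambda>x. if x \<in> \<Omega> then f x else 0) measurable_on UNIV"
      by (intro lebesgue_measurable_imp_measurable_on) auto
    then obtain N g where N: "negligible N" and g: "\<And>n. continuous_on UNIV (g n :: real \<Rightarrow> complex)"
      and lim: "\<And>x. x \<notin> N \<Longrightarrow> (\<lambda>n. g n x) \<longlonglongrightarrow> (if x \<in> \<Omega> then f x else 0)"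
      unfolding measurable_on_def by auto
    have "\<exists>k. \<exists>qs\<in>lists Q. \<forall>x\<in>\<Omega>. cmod (g n x - step_fun k qs x) < inverse (real (Suc n))" for n
      by (rule continuous_step_approx[OF g _ Q(2)]) auto
    then obtain k qs where qs: "\<And>n. qs n \<in> lists Q"
      and st: "\<And>n x. x \<in> \<Omega> \<Longrightarrow> cmod (g n x - step_fun (k n) (qs n) x) < inverse (real (Suc n))"
      by metis
    \<comment> \<open>The threshold exceeds the bound for f, so cutting does not affect the limit of the step functions at points where they converge to f.\<close>
    define cut where "cut z = (if cmod z \<le> 2 * m then z else 0)" for z
    define p where "p n = step_fun (k n) (map cut (qs n))" for n
    have p_eq: "p n x = cut (step_fun (k n) (qs n) x)" for n x
      unfolding p_def by (rule step_fun_map) (simp add: cut_def)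
    have p_D: "p n \<in> D" for n
    proof -
      have "map cut (qs n) \<in> lists (insert 0 Q)"
        using qs[of n] by (auto simp: cut_def)
      then show ?thesis by (auto simp: D_def p_def)
    qed
    have p_lim: "(\<lambda>n. f x - p n x) \<longlonglongrightarrow> 0" if x: "x \<in> \<Omega>" "x \<notin> N" for x
    proof -
      have "(\<lambda>n. g n x - step_fun (k n) (qs n) x) \<longlonglongrightarrow> 0"
        using st[OF x(1)] by (intro Lim_null_comparison[OF _ LIMSEQ_inverse_real_of_nat])
          (auto intro!: always_eventually less_imp_le)
      from tendsto_diff[OF lim[OF x(2)] this]
      have s: "(\<lambda>n. step_fun (k n) (qs n) x) \<longlonglongrightarrow> f x" using x(1) by simp
      have "eventually (\<lambda>n. cmod (step_fun (k n) (qs n) x) < 2 * m) sequentially"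
        using m(2)[of x] m(1) by (intro order_tendstoD(2)[OF tendsto_norm[OF s]]) linarith
      then have "eventually (\<lambda>n. step_fun (k n) (qs n) x = p n x) sequentially"
        by eventually_elim (simp add: p_eq cut_def)
      then have "(\<lambda>n. p n x) \<longlonglongrightarrow> f x"
        using s by (rule Lim_transform_eventually[rotated])
      from tendsto_diff[OF tendsto_const[of "f x"] this] show ?thesis by simp
    qed
    have "\<exists>n. lux (\<lambda>x. f x - p n x) \<le> ennreal e"
    proof (rule lux_dominated_convergence[where H="\<lambda>x. of_real (3 * m)"])
      show "(\<lambda>x. f x - p n x) \<in> borel_measurable M" for n
        using f step_fun_measurable by (auto simp: p_def)
      have "AE x in lebesgue. x \<notin> N"
        using N by (intro AE_not_in) (simp add: negligible_iff_null_sets)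
      then have "AE x in M. x \<notin> N"
        by (subst AE_restrict_space_iff) (auto elim: eventually_mono)
      then show "AE x in M. (\<lambda>n. f x - p n x) \<longlonglongrightarrow> 0"
        using AE_space by eventually_elim (use p_lim in auto)
      show "AE x in M. cmod (f x - p n x) \<le> cmod (of_real (3 * m))" for n
      proof (rule AE_I2)
        fix x
        have "cmod (p n x) \<le> 2 * m" using m(1) by (simp add: p_eq cut_def)
        then have "cmod (f x - p n x) \<le> 3 * m"
          using norm_triangle_ineq4[of "f x" "p n x"] m(2)[of x] by linarith
        then show "cmod (f x - p n x) \<le> cmod (of_real (3 * m))" using m(1) by (simp del: of_real_mult)
      qed
      show "modular (\<lambda>x. of_real c * of_real (3 * m)) < \<infinity>" for c
        using emeasure_M by (simp add: orlicz_modular_def ennreal_mult_less_top)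
    qed (use e in auto)
    then show ?thesis using p_D by blast
  qed
  show thesis
  proof (rule that[of D])
    show "countable D"
      unfolding D_def using Q(1) by (intro countable_image countable_SIGMA countable_lists) auto
    show D_meas: "D \<subseteq> borel_measurable M"
      using step_fun_measurable by (auto simp: D_def)
    show "\<forall>f e. f \<in> borel_measurable M \<longrightarrow> lux f < \<infinity> \<longrightarrow> e > 0 \<longrightarrow> (\<exists>p\<in>D. lux (\<lambda>x. f x - p x) \<le> ennreal e)"
    proof (intro allI impI)
      fix f :: "real \<Rightarrow> complex" and e :: real
      assume f [measurable]: "f \<in> borel_measurable M" and fin: "lux f < \<infinity>" and e: "e > 0"
      define F where "F n x = (if cmod (f x) \<le> real n then f x else 0)" for n x
      have F_meas [measurable]: "F n \<in> borel_measurable M" for n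
        unfolding F_def[abs_def] by measurable
      have F_bound: "cmod (F n x) \<le> real n + 1" for n x
        by (simp add: F_def)
      have "\<exists>n. lux (\<lambda>x. f x - F n x) \<le> ennreal (e / 2)"
      proof (rule lux_dominated_convergence[where H=f])
        show "AE x in M. (\<lambda>n. f x - F n x) \<longlonglongrightarrow> 0"
        proof (intro AE_I2 tendsto_eventually)
          fix x
          obtain n0 :: nat where "cmod (f x) \<le> real n0" using real_arch_simple by blast
          then show "eventually (\<lambda>n. f x - F n x = 0) sequentially"
            by (intro eventually_sequentiallyI[of n0]) (auto simp: F_def)
        qed
        show "modular (\<lambda>x. of_real c * f x) < \<infinity>" for c
          by (rule modular_scale_finite[OF D2 f fin])
      qed (use e in \<open>auto simp: F_def\<close>)
      then obtain n where n: "lux (\<lambda>x. f x - F n x) \<le> ennreal (e / 2)" by blast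
      obtain p where p: "p \<in> D" "lux (\<lambda>x. F n x - p x) \<le> ennreal (e / 2)"
        using bounded_approx[OF F_meas[of n] _ F_bound[of n], of "e / 2"] e by auto
      have "lux (\<lambda>x. f x - p x) \<le> lux (\<lambda>x. f x - F n x) + lux (\<lambda>x. F n x - p x)"
        using p(1) D_meas by (intro lux_triangle_diff) auto
      also have "\<dots> \<le> ennreal (e / 2) + ennreal (e / 2)"
        by (intro add_mono n p)
      also have "\<dots> = ennreal e" using e by (simp flip: ennreal_plus)
      finally show "\<exists>p\<in>D. lux (\<lambda>x. f x - p x) \<le> ennreal e" using p(1) by blast
    qed
  qed
qed

section \<open>The obstruction from separability\<close>

text \<open>
  The indicator functions of the subsets of \<open>\<nat>\<close> have mutual distance \<open>1\<close> in \<open>\<ell>\<^sup>\<infinity>\<close>. Their preimages under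
  an isomorphism would be uncountably many isolated points; approximating each of them and its derivative
  from a countable set, at a scale that its isolation radius dictates, assigns to them pairwise different
  elements of a countable set.
\<close>

lemma Delta2_no_ell_infty:
  assumes D2: "Delta2_infty \<phi>"
  shows "\<not> contains_subspace_isomorphic_to X ell_infty"
proof
  assume "contains_subspace_isomorphic_to X ell_infty"
  then obtain V T where V: "linear_subspace V X"
    and T: "homeomorphic_map (norm_topology (X\<lparr>carr := V\<rparr>)) (norm_topology ell_infty) T"
    by (auto simp: contains_subspace_isomorphic_to_def isomorphic_spaces_def)
  let ?d = "norm_dist (X\<lparr>carr := V\<rparr>)"
  have VX: "V \<subseteq> carr X" using V by (simp add: linear_subspace_def)
  interpret V: Metric_space V ?d by (rule Metric_space_subset[OF VX])
  interpret ell: Metric_space "carr ell_infty" "norm_dist ell_infty" by (rule Metric_space_ell_infty)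
  have T': "homeomorphic_map V.mtopology ell.mtopology T"
    using T by (simp add: norm_topology_def)
  have surj: "T ` V = carr ell_infty"
    using homeomorphic_imp_surjective_map[OF T'] by simp
  have cont: "\<forall>a\<in>V. \<forall>\<epsilon>>0. \<exists>\<delta>>0. \<forall>x. x \<in> V \<and> ?d a x < \<delta> \<longrightarrow> norm_dist ell_infty (T a) (T x) < \<epsilon>"
    using homeomorphic_imp_continuous_map[OF T']
    by (simp add: V.metric_continuous_map[OF Metric_space_ell_infty])
  define ind where "ind S n = (if n \<in> S then 1 else 0 :: complex)" for S :: "nat set" and n
  have ind_in: "ind S \<in> carr ell_infty" for S
    by (auto simp: ell_infty_simps ind_def bounded_iff intro!: exI[of _ 1])
  have ind_dist: "1 \<le> norm_dist ell_infty (ind S) (ind S')" if ne: "S \<noteq> S'" for S S'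
  proof -
    obtain n where "n \<in> S \<longleftrightarrow> n \<notin> S'" using ne by blast
    then have "cmod (ind S n - ind S' n) = 1" by (auto simp: ind_def)
    then show ?thesis using ell_infty_dist_ge[OF ind_in ind_in, of S n S'] by simp
  qed
  have "\<exists>f n. f \<in> sob \<and> cls f \<in> V \<and> T (cls f) = ind S \<and>
      (\<forall>v\<in>V. ?d (cls f) v \<le> inverse (real (Suc n)) \<longrightarrow> norm_dist ell_infty (ind S) (T v) < 1)" for S
  proof -
    obtain v where v: "v \<in> V" "T v = ind S" using surj ind_in[of S] by (metis imageE)
    obtain f where f: "f \<in> sob" "v = cls f" using v(1) VX by (auto simp: carr_X)
    obtain \<delta> where \<delta>: "\<delta> > 0" "\<And>x. x \<in> V \<Longrightarrow> ?d v x < \<delta> \<Longrightarrow> norm_dist ell_infty (T v) (T x) < 1"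
      using cont v(1) by (metis zero_less_one)
    obtain n where "inverse (real (Suc n)) < \<delta>" using reals_Archimedean[OF \<delta>(1)] by blast
    then show ?thesis using v f \<delta>(2) by (intro exI[of _ f] exI[of _ n]) auto
  qed
  then obtain f n where f: "\<And>S. f S \<in> sob" and f_V: "\<And>S. cls (f S) \<in> V" and Tf: "\<And>S. T (cls (f S)) = ind S"
    and sep: "\<And>S v. v \<in> V \<Longrightarrow> ?d (cls (f S)) v \<le> inverse (real (Suc (n S))) \<Longrightarrow> norm_dist ell_infty (ind S) (T v) < 1"
    by metis
  obtain D where D: "countable D" "D \<subseteq> borel_measurable M"
    "\<forall>f e. f \<in> borel_measurable M \<longrightarrow> lux f < \<infinity> \<longrightarrow> e > 0 \<longrightarrow> (\<exists>p\<in>D. lux (\<lambda>x. f x - p x) \<le> ennreal e)"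
    by (rule Delta2_separable[OF D2])
  \<comment> \<open>Each of the two components contributes two approximation errors.\<close>
  define e where "e S = inverse (real (Suc (n S))) / 4" for S
  have e: "e S > 0" for S by (simp add: e_def)
  have "\<exists>p\<in>D. lux (\<lambda>x. f S x - p x) \<le> ennreal (e S)" for S
    using D(3) sobolev_functionsD[OF f[of S]] e[of S] by blast
  then obtain p where p: "\<And>S. p S \<in> D" "\<And>S. lux (\<lambda>x. f S x - p S x) \<le> ennreal (e S)" by metis
  have "\<exists>q\<in>D. lux (\<lambda>x. weak_deriv \<Omega> (f S) x - q x) \<le> ennreal (e S)" for S
    using D(3) sobolev_functionsD[OF f[of S]] e[of S] by blast
  then obtain q where q: "\<And>S. q S \<in> D" "\<And>S. lux (\<lambda>x. weak_deriv \<Omega> (f S) x - q S x) \<le> ennreal (e S)" by metis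
  have close: "lux (\<lambda>x. a x - b x) \<le> ennreal (2 * e S)"
    if "lux (\<lambda>x. a x - r x) \<le> ennreal (e S)" "lux (\<lambda>x. b x - r x) \<le> ennreal (e S)"
      "a \<in> borel_measurable M" "b \<in> borel_measurable M" "r \<in> borel_measurable M" for a b r S
  proof -
    have "lux (\<lambda>x. a x - b x) \<le> lux (\<lambda>x. a x - r x) + lux (\<lambda>x. r x - b x)"
      by (intro lux_triangle_diff that)
    also have "\<dots> \<le> ennreal (e S) + ennreal (e S)"
      using that by (intro add_mono) (auto simp: lux_minus_commute[of r b])
    finally show ?thesis using e[of S] by (simp flip: ennreal_plus)
  qed
  \<comment> \<open>Equal codes would put two preimages within the isolation radius of each other.\<close>
  have "inj (\<lambda>S. (n S, p S, q S))"
  proof (rule injI, rule ccontr)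
    fix S S' assume eq: "(n S, p S, q S) = (n S', p S', q S')" and "S \<noteq> S'"
    then have eS: "e S' = e S" by (simp add: e_def)
    note m = sobolev_functionsD(5,6)[OF f]
    have "lux (\<lambda>x. f S x - f S' x) \<le> ennreal (2 * e S)"
      using p[of S] p[of S'] D(2) eq eS m by (intro close[of _ "p S"]) auto
    moreover have "lux (\<lambda>x. weak_deriv \<Omega> (f S) x - weak_deriv \<Omega> (f S') x) \<le> ennreal (2 * e S)"
      using q[of S] q[of S'] D(2) eq eS m by (intro close[of _ "q S"]) auto
    ultimately have "snorm (\<lambda>x. f S x - f S' x) \<le> ennreal (2 * e S) + ennreal (2 * e S)"
      unfolding snorm_diff[OF f f] by (rule add_mono)
    also have "\<dots> = ennreal (4 * e S)" using e[of S] by (simp flip: ennreal_plus)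
    finally have "enn2real (snorm (\<lambda>x. f S x - f S' x)) \<le> 4 * e S"
      using e[of S] by (intro enn2real_leI) auto
    then have "?d (cls (f S)) (cls (f S')) \<le> inverse (real (Suc (n S)))"
      by (simp add: norm_dist_cls[OF VX f f_V f f_V] e_def)
    then have "norm_dist ell_infty (ind S) (T (cls (f S'))) < 1" by (intro sep f_V)
    then show False using ind_dist[OF \<open>S \<noteq> S'\<close>] by (simp add: Tf)
  qed
  moreover have "countable (range (\<lambda>S. (n S, p S, q S)))"
    by (rule countable_subset[of _ "UNIV \<times> D \<times> D"]) (use p(1) q(1) D(1) in auto)
  ultimately have "countable (UNIV :: nat set set)"
    by (rule countable_image_inj_on[rotated])
  then obtain h :: "nat set \<Rightarrow> nat" where "inj h"
    by (auto elim: countableE)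
  then have "surj (inv h)" by (rule inj_imp_surj_inv)
  then show False using Cantors_theorem[of "UNIV :: nat set"] by (metis Pow_UNIV)
qed

end

theorem corollary3p6:
  fixes \<alpha> \<beta> :: real and \<phi> :: "real \<Rightarrow> real"
  assumes "\<alpha> < \<beta>"
    and "orlicz_function \<phi>"
  shows "contains_subspace_isomorphic_to (orlicz_sobolev {\<alpha><..<\<beta>} \<phi>) ell_infty
           \<longleftrightarrow> \<not> Delta2_infty \<phi>"
proof -
  interpret orlicz_interval \<alpha> \<beta> \<phi>
    using assms by unfold_locales
  show ?thesis using contains_ell_infty Delta2_no_ell_infty by blast
qed

end
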